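(* Let $\Delta>0$ and $c>0$ be constants, and let $(G_n)_{n\ge 1}$ be a sequence of finite graphs such that every vertex of every $G_n$ has degree at most $\Delta$ and the Cheeger constants satisfy $h(G_n)\ge c$ for all $n$. Suppose that $G_n$ converges locally weakly to an infinite random rooted graph $(G,\rho)$. Let $p_c(G)$ denote the almost surely constant value of the critical probability of Bernoulli bond percolation on $G$, and let $p\in[0,1]$. Let $G_n(p)$ be the random graph of open edges obtained from $G_n$ by Bernoulli bond percolation with parameter $p$. If $p<p_c(G)$, then for any constant $\alpha>0$, $$\mathbb{P}\big(G_n(p)\text{ contains a component of size at least }\alpha|G_n|\big)\to 0\quad\text{as } n\to\infty.$$ If $p>p_c(G)$, then there exists some $\alpha=\alpha(p)>0$ such that $$\mathbb{P}\big(G_n(p)\text{ contains a component of size at least }\alpha|G_n|\big)\to 1\quad\text{as } n\to\infty.$$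
   Context: Rooted graphs. A rooted graph $(G,o)$ is a connected graph $G$ with a distinguished vertex $o$. Two rooted graphs are isomorphic, $(G,o)\cong(G',o')$, if there is a graph isomorphism from $G$ onto $G'$ taking $o$ to $o'$. $\mathcal{G}$ is the space of isomorphism classes of rooted connected graphs with all degrees at most $\Delta$. $B_G(o,r)$ is the closed ball of radius $r$ around $o$ in $G$ for the graph distance, viewed as a graph rooted at $o$. $\mathcal{G}$ carries the metric $D((G_1,o_1),(G_2,o_2))=\frac{1}{1+t}$ with $t=\sup\{s: B_{G_1}(o_1,s)\cong B_{G_2}(o_2,s)\}$ (so $D=0$ if $t=\infty$), which makes it a compact separable metric space, and the corresponding Borel $\sigma$-field. A random rooted graph is a sample from a Borel probability measure $\mu$ on $\mathcal{G}$; it is infinite if the sampled graph is almost surely infinite. Local weak convergence. For each $n$, let $U_n$ be a uniformly chosen random vertex of the finite graph $G_n$. $G_n$ converges locally weakly to $(G,\rho)$ if for every $R>0$ and every finite rooted graph $(H,\rho')$, $\mathbb{P}\big((B_{G_n}(U_n,R),U_n)\cong(H,\rho')\big)\to\mathbb{P}\big((B_G(\rho,R),\rho)\cong(H,\rho')\big)$ as $n\to\infty$. Cheeger constant. For a finite graph $G=(V,E)$, $h(G)=\min_{A\subseteq V}\{|E(A,V\setminus A)|/|A| : 0<|A|\le |V|/2\}$, where $E(A,B)$ is the set of edges with one endpoint in $A$ and the other in $B$. Percolation. $\mathbb{P}_p$ denotes Bernoulli bond percolation with parameter $p$: each edge is independently open with probability $p$ and closed with probability $1-p$. For an infinite graph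 $\tau$ with bounded degrees, $p_c(\tau)=\inf\{p\in[0,1]:\mathbb{P}_p(\text{there exists an infinite open component})>0\}$. Under the hypotheses of the claim, the random variable $p_c(G)$ is almost surely equal to a constant (a separate theorem of the paper), so $p_c(G)$ is well defined as a number. $|G_n|$ is the number of vertices of $G_n$, and the size of a component is its number of vertices. *)

theory Defs
  imports "HOL-Probability.Probability"
begin

section \<open>Graphs\<close>

text \<open>A graph is a pair (vertices, edges), an edge being the set of its two endpoints.\<close>

type_synonym 'v graph = "'v set \<times> 'v set set"

abbreviation verts :: "'v graph \<Rightarrow> 'v set" where "verts \<equiv> fst"
abbreviation edges :: "'v graph \<Rightarrow> 'v set set" where "edges \<equiv> snd"

definition simple_graph :: "'v graph \<Rightarrow> bool" where
  "simple_graph G \<longleftrightarrow> (\<forall>e\<in>edges G. e \<subseteq> verts G \<and> card e = 2)"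

definition finite_graph :: "'v graph \<Rightarrow> bool" where
  "finite_graph G \<longleftrightarrow> simple_graph G \<and> finite (verts G) \<and> verts G \<noteq> {}"

text \<open>The finiteness conjunct is needed because \<^const>\<open>card\<close> of an infinite set is 0.\<close>

definition degrees_at_most :: "'v graph \<Rightarrow> nat \<Rightarrow> bool" where
  "degrees_at_most G \<Delta> \<longleftrightarrow>
     (\<forall>v\<in>verts G. finite {e \<in> edges G. v \<in> e} \<and> card {e \<in> edges G. v \<in> e} \<le> \<Delta>)"

definition adj :: "'v graph \<Rightarrow> ('v \<times> 'v) set" where
  "adj G = {(u, v). {u, v} \<in> edges G}"

definition connected_graph :: "'v graph \<Rightarrow> bool" where
  "connected_graph G \<longleftrightarrow> (\<forall>u\<in>verts G. \<forall>v\<in>verts G. (u, v) \<in> (adj G)\<^sup>*)"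

definition graph_component :: "'v graph \<Rightarrow> 'v \<Rightarrow> 'v set" where
  "graph_component G v = {w \<in> verts G. (v, w) \<in> (adj G)\<^sup>*}"

definition graph_components :: "'v graph \<Rightarrow> 'v set set" where
  "graph_components G = graph_component G ` verts G"

text \<open>Length of a shortest path, \<open>\<infinity>\<close> if there is none.\<close>

definition graph_dist :: "'v graph \<Rightarrow> 'v \<Rightarrow> 'v \<Rightarrow> enat" where
  "graph_dist G u v = (INF k\<in>{k. (u, v) \<in> adj G ^^ k}. enat k)"

definition induced_subgraph :: "'v graph \<Rightarrow> 'v set \<Rightarrow> 'v graph" where
  "induced_subgraph G S = (S, {e \<in> edges G. e \<subseteq> S})"

section \<open>Cheeger constant\<close>

definition edges_between :: "'v graph \<Rightarrow> 'v set \<Rightarrow> 'v set \<Rightarrow> 'v set set" where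
  "edges_between G A B = {e \<in> edges G. \<exists>a\<in>A. \<exists>b\<in>B. e = {a, b}}"

text \<open>
  The infimum is over a finite set, hence a minimum, as soon as the finite graph has
  at least two vertices.  For a one-vertex graph no set \<open>A\<close> is admissible and the value
  is \<open>\<infinity>\<close>; this is why the values are extended reals.
\<close>

definition cheeger :: "'v graph \<Rightarrow> ereal" where
  "cheeger G =
     (INF A\<in>{A. A \<subseteq> verts G \<and> 0 < card A \<and> real (card A) \<le> real (card (verts G)) / 2}.
        ereal (real (card (edges_between G A (verts G - A))) / real (card A)))"

section \<open>Rooted graphs\<close>

type_synonym 'v rooted = "'v graph \<times> 'v"

definition rooted_graph :: "'v rooted \<Rightarrow> bool" where
  "rooted_graph x \<longleftrightarrow>
     (case x of (G, v) \<Rightarrow> simple_graph G \<and> connected_graph G \<and> v \<in> verts G)"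

definition rooted_iso :: "'v rooted \<Rightarrow> 'w rooted \<Rightarrow> bool" (infix "\<cong>\<^sub>r" 50) where
  "x \<cong>\<^sub>r y \<longleftrightarrow>
     (case (x, y) of ((G, u), (H, v)) \<Rightarrow>
       \<exists>f. bij_betw f (verts G) (verts H) \<and> (\<lambda>e. f ` e) ` edges G = edges H \<and> f u = v)"

definition rooted_ball :: "'v rooted \<Rightarrow> real \<Rightarrow> 'v rooted" where
  "rooted_ball x r =
     (case x of (G, v) \<Rightarrow>
       (induced_subgraph G {w \<in> verts G. ereal_of_enat (graph_dist G v w) \<le> ereal r}, v))"

text \<open>
  A connected graph of bounded degree is countable, so every isomorphism class has a
  representative with vertices in \<^typ>\<open>nat\<close>.
\<close>

definition rooted_graphs :: "nat \<Rightarrow> nat rooted set" where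
  "rooted_graphs \<Delta> = {x. rooted_graph x \<and> degrees_at_most (fst x) \<Delta>}"

definition graph_space :: "nat \<Rightarrow> nat rooted set set" where
  "graph_space \<Delta> =
     rooted_graphs \<Delta> // {(x, y). x \<in> rooted_graphs \<Delta> \<and> y \<in> rooted_graphs \<Delta> \<and> x \<cong>\<^sub>r y}"

text \<open>
  A representative of an isomorphism class.  It is only used for properties that are
  invariant under rooted isomorphism, so the choice is immaterial.
\<close>

definition rep :: "nat rooted set \<Rightarrow> nat rooted" where
  "rep X = (SOME x. x \<in> X)"

text \<open>In \<^typ>\<open>ereal\<close> one has \<open>1 / (1 + \<infinity>) = 0\<close>.\<close>

definition local_dist :: "nat rooted set \<Rightarrow> nat rooted set \<Rightarrow> real" where
  "local_dist X Y =
     real_of_ereal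
       (1 / (1 + (SUP s\<in>{s. 0 \<le> s \<and> rooted_ball (rep X) s \<cong>\<^sub>r rooted_ball (rep Y) s}. ereal s)))"

definition graph_borel :: "nat \<Rightarrow> nat rooted set measure" where
  "graph_borel \<Delta> =
     sigma (graph_space \<Delta>)
       {U. openin (Metric_space.mtopology (graph_space \<Delta>) local_dist) U}"

definition random_rooted_graph :: "nat \<Rightarrow> nat rooted set measure \<Rightarrow> bool" where
  "random_rooted_graph \<Delta> \<mu> \<longleftrightarrow> prob_space \<mu> \<and> sets \<mu> = sets (graph_borel \<Delta>)"

definition almost_surely_infinite :: "nat rooted set measure \<Rightarrow> bool" where
  "almost_surely_infinite \<mu> \<longleftrightarrow> (AE X in \<mu>. infinite (verts (fst (rep X))))"

definition locally_weakly_converges ::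
    "(nat \<Rightarrow> 'v graph) \<Rightarrow> nat rooted set measure \<Rightarrow> bool" where
  "locally_weakly_converges G \<mu> \<longleftrightarrow>
     (\<forall>R>0. \<forall>H :: nat rooted. rooted_graph H \<and> finite (verts (fst H)) \<longrightarrow>
        (\<lambda>n. measure (measure_pmf (pmf_of_set (verts (G n)))) {u. rooted_ball (G n, u) R \<cong>\<^sub>r H})
          \<longlonglongrightarrow> measure \<mu> {X \<in> space \<mu>. rooted_ball (rep X) R \<cong>\<^sub>r H})"

section \<open>Bernoulli bond percolation\<close>

definition percolation :: "'v graph \<Rightarrow> real \<Rightarrow> ('v set \<Rightarrow> bool) measure" where
  "percolation G p = PiM (edges G) (\<lambda>_. measure_pmf (bernoulli_pmf p))"

definition open_graph :: "'v graph \<Rightarrow> ('v set \<Rightarrow> bool) \<Rightarrow> 'v graph" where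
  "open_graph G \<omega> = (verts G, {e \<in> edges G. \<omega> e})"

definition prob_infinite_component :: "'v graph \<Rightarrow> real \<Rightarrow> real" where
  "prob_infinite_component G p =
     measure (percolation G p)
       {\<omega> \<in> space (percolation G p). \<exists>C\<in>graph_components (open_graph G \<omega>). infinite C}"

definition critical_prob :: "'v graph \<Rightarrow> real" where
  "critical_prob G = Inf {p \<in> {0..1}. prob_infinite_component G p > 0}"

definition prob_giant_component :: "'v graph \<Rightarrow> real \<Rightarrow> real \<Rightarrow> real" where
  "prob_giant_component G p \<alpha> =
     measure (percolation G p)
       {\<omega> \<in> space (percolation G p).
          \<exists>C\<in>graph_components (open_graph G \<omega>). real (card C) \<ge> \<alpha> * real (card (verts G))}"

end

theory Submission
  imports Defs
begin

text \<open>
  Whether the component of a vertex has at least \<open>k\<close> vertices depends only on the ball of radius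
  \<open>k\<close>, so the mean proportion of such vertices in \<open>G\<^sub>n(p)\<close> converges to the corresponding
  probability at the root of the limit, and the latter decreases, as \<open>k\<close> grows, to the
  probability that the root percolates.  Below \<open>p\<^sub>c\<close> this is \<open>0\<close> and Markov's inequality suffices.

  Above \<open>p\<^sub>c\<close>, write \<open>p = a + (1 - a) b\<close> with \<open>p\<^sub>c < a\<close>.  For every \<open>k\<close>, a proportion bounded
  below of the vertices lies in \<open>a\<close>-open components of size at least \<open>k\<close>, with high probability by
  Chebyshev's inequality.  If adding independent \<open>b\<close>-open edges creates no giant component, these
  components (at most \<open>n / k\<close> of them) split into two parts \<open>A\<close>, \<open>B\<close> of linear size not joined by
  \<open>b\<close>-open paths.  By expansion there are linearly many edge-disjoint connections of bounded
  length between \<open>A\<close> and \<open>B\<close>, so a given split has probability at most \<open>exp (- \<beta> n)\<close> with \<open>\<beta>\<close>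
  independent of \<open>k\<close>, which beats the number \<open>2\<^bsup>n/k\<^esup>\<close> of splits for large \<open>k\<close>.
\<close>


text \<open>The local limit sees only balls of bounded radius and says nothing directly about
  components of linear size. Both regimes therefore pass through a cutoff \<open>k\<close>, and the
  order in which the constants are fixed is decisive. The number \<open>\<theta>\<close>, the mean
  probability that the root percolates at level \<open>a\<close>, bounds the limiting proportion of
  vertices in components of size at least \<open>k\<close> from below for all \<open>k\<close> at
  once. From it come \<open>\<alpha>\<close>, then the path length \<open>L\<close> and the rate
  \<open>\<beta>\<close>; only then is \<open>k\<close> chosen against \<open>\<beta>\<close>, and
  \<open>n\<close> grows last. A parameter above the critical one yields an infinite component
  somewhere, whereas the limit looks at the root. Sprinkling along a fixed path to the root, inside
  the infinite graph, closes this gap. In both places sprinkling is an identity of product measures: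
  the union of two independent configurations is again a Bernoulli configuration. Splits are
  recorded as families of components of the first configuration alone, so that the second one can be
  estimated with the first held fixed.\<close>

lemma adj_sym: "(u, v) \<in> adj G \<Longrightarrow> (v, u) \<in> adj G"
  by (simp add: adj_def insert_commute)

lemma adj_rtrancl_sym: "(u, v) \<in> (adj G)\<^sup>* \<Longrightarrow> (v, u) \<in> (adj G)\<^sup>*"
  by (meson adj_sym symD symI sym_rtrancl)

subsection \<open>Balls\<close>

fun nball :: "'v graph \<Rightarrow> 'v \<Rightarrow> nat \<Rightarrow> 'v set" where
  "nball G v 0 = {v}"
| "nball G v (Suc j) = nball G v j \<union> {w. \<exists>u\<in>nball G v j. {u, w} \<in> edges G}"

lemma nball_mono: "i \<le> j \<Longrightarrow> nball G v i \<subseteq> nball G v j"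
  by (induction j) (auto simp: le_Suc_eq)

lemma center_in_nball [simp]: "v \<in> nball G v j"
  using nball_mono[of 0 j G v] by simp

lemma nball_subset_verts: "simple_graph G \<Longrightarrow> v \<in> verts G \<Longrightarrow> nball G v j \<subseteq> verts G"
  by (induction j) (auto simp: simple_graph_def)

lemma nball_iff_relpow: "w \<in> nball G v j \<longleftrightarrow> (\<exists>i\<le>j. (v, w) \<in> adj G ^^ i)"
proof (induction j arbitrary: w)
  case (Suc j)
  have "w \<in> nball G v (Suc j) \<longleftrightarrow> w \<in> nball G v j \<or> (\<exists>u\<in>nball G v j. (u, w) \<in> adj G)"
    by (auto simp: adj_def)
  also have "\<dots> \<longleftrightarrow> (\<exists>i\<le>Suc j. (v, w) \<in> adj G ^^ i)"
  proof
    assume "w \<in> nball G v j \<or> (\<exists>u\<in>nball G v j. (u, w) \<in> adj G)"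
    then show "\<exists>i\<le>Suc j. (v, w) \<in> adj G ^^ i"
    proof
      assume "w \<in> nball G v j"
      then show ?thesis using Suc.IH le_SucI by blast
    next
      assume "\<exists>u\<in>nball G v j. (u, w) \<in> adj G"
      then obtain u i where "i \<le> j" "(v, u) \<in> adj G ^^ i" "(u, w) \<in> adj G"
        using Suc.IH by blast
      then show ?thesis by (intro exI[of _ "Suc i"]) auto
    qed
  next
    assume "\<exists>i\<le>Suc j. (v, w) \<in> adj G ^^ i"
    then obtain i where i: "i \<le> Suc j" "(v, w) \<in> adj G ^^ i" by blast
    show "w \<in> nball G v j \<or> (\<exists>u\<in>nball G v j. (u, w) \<in> adj G)"
    proof (cases i)
      case 0
      then show ?thesis using i by auto
    next
      case (Suc i')
      then obtain u where "(v, u) \<in> adj G ^^ i'" "(u, w) \<in> adj G" using i by auto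
      then show ?thesis using Suc.IH[of u] i Suc by auto
    qed
  qed
  finally show ?case .
qed auto

lemma Union_nball: "(\<Union>j. nball G v j) = {w. (v, w) \<in> (adj G)\<^sup>*}"
proof (rule set_eqI)
  fix w
  have "(\<exists>j i. i \<le> j \<and> (v, w) \<in> adj G ^^ i) \<longleftrightarrow> (\<exists>i. (v, w) \<in> adj G ^^ i)" by blast
  then show "w \<in> (\<Union>j. nball G v j) \<longleftrightarrow> w \<in> {w. (v, w) \<in> (adj G)\<^sup>*}"
    by (simp add: nball_iff_relpow rtrancl_power)
qed

lemma graph_component_eq_Union_nball:
  "simple_graph G \<Longrightarrow> v \<in> verts G \<Longrightarrow> graph_component G v = (\<Union>j. nball G v j)"
  using nball_subset_verts[of G v] Union_nball[of G v] unfolding graph_component_def by blast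

lemma nball_sym: "w \<in> nball G v j \<Longrightarrow> v \<in> nball G w j"
proof -
  have "(u, w) \<in> adj G ^^ i \<Longrightarrow> (w, u) \<in> adj G ^^ i" for u w i
  proof (induction i arbitrary: w)
    case (Suc i)
    then obtain x where "(u, x) \<in> adj G ^^ i" "(x, w) \<in> adj G" by auto
    then show ?case using Suc.IH adj_sym relpow_Suc_I2 by metis
  qed simp
  then show "w \<in> nball G v j \<Longrightarrow> v \<in> nball G w j" by (auto simp: nball_iff_relpow)
qed

lemma nball_trans:
  assumes "w \<in> nball G v i" "x \<in> nball G w j" shows "x \<in> nball G v (i + j)"
proof -
  obtain i' j' where "i' \<le> i" "(v, w) \<in> adj G ^^ i'" "j' \<le> j" "(w, x) \<in> adj G ^^ j'"
    using assms by (auto simp: nball_iff_relpow)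
  then have "i' + j' \<le> i + j" "(v, x) \<in> adj G ^^ (i' + j')"
    by (auto simp: relpow_add)
  then show ?thesis unfolding nball_iff_relpow by blast
qed

lemma neighbours_bound:
  assumes "simple_graph G" "degrees_at_most G \<Delta>"
  shows "finite {w. {u, w} \<in> edges G}" "card {w. {u, w} \<in> edges G} \<le> \<Delta>"
proof -
  have "finite {w. {u, w} \<in> edges G} \<and> card {w. {u, w} \<in> edges G} \<le> \<Delta>"
  proof (cases "u \<in> verts G")
    case True
    have inj: "inj_on (\<lambda>w. {u, w}) {w. {u, w} \<in> edges G}"
      by (auto simp: inj_on_def doubleton_eq_iff)
    have sub: "(\<lambda>w. {u, w}) ` {w. {u, w} \<in> edges G} \<subseteq> {e \<in> edges G. u \<in> e}" by auto
    have "finite {e \<in> edges G. u \<in> e}" "card {e \<in> edges G. u \<in> e} \<le> \<Delta>"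
      using assms True by (auto simp: degrees_at_most_def)
    then show ?thesis
      using inj_on_finite[OF inj sub] card_inj_on_le[OF inj sub] by linarith
  next
    case False
    then have "{w. {u, w} \<in> edges G} = {}" using assms by (auto simp: simple_graph_def)
    then show ?thesis by simp
  qed
  then show "finite {w. {u, w} \<in> edges G}" "card {w. {u, w} \<in> edges G} \<le> \<Delta>" by auto
qed

lemma nball_bound:
  assumes "simple_graph G" "degrees_at_most G \<Delta>"
  shows "finite (nball G v j) \<and> card (nball G v j) \<le> Suc \<Delta> ^ j"
proof (induction j)
  case (Suc j)
  have eq: "nball G v (Suc j) = nball G v j \<union> (\<Union>u\<in>nball G v j. {w. {u, w} \<in> edges G})" by auto
  have "card (\<Union>u\<in>nball G v j. {w. {u, w} \<in> edges G})
      \<le> (\<Sum>u\<in>nball G v j. card {w. {u, w} \<in> edges G})"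
    using Suc by (intro card_UN_le) auto
  also have "\<dots> \<le> (\<Sum>u\<in>nball G v j. \<Delta>)"
    using assms by (intro sum_mono neighbours_bound)
  finally have "card (\<Union>u\<in>nball G v j. {w. {u, w} \<in> edges G}) \<le> card (nball G v j) * \<Delta>"
    by simp
  then have "card (nball G v (Suc j)) \<le> card (nball G v j) + card (nball G v j) * \<Delta>"
    unfolding eq by (meson add_left_mono card_Un_le order_trans)
  also have "\<dots> \<le> Suc \<Delta> ^ Suc j" using Suc by (simp add: mult.commute[of _ \<Delta>] add_mono)
  finally show ?case unfolding eq using Suc neighbours_bound[OF assms] by auto
qed auto

lemmas finite_nball = nball_bound[THEN conjunct1]
  and card_nball_le = nball_bound[THEN conjunct2]

lemma degrees_at_most_subgraph:
  assumes "degrees_at_most G \<Delta>" "verts H \<subseteq> verts G" "edges H \<subseteq> edges G"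
  shows "degrees_at_most H \<Delta>"
proof -
  have "{e \<in> edges H. v \<in> e} \<subseteq> {e \<in> edges G. v \<in> e}" for v using assms by auto
  then show ?thesis using assms unfolding degrees_at_most_def
    by (meson card_mono finite_subset order_trans subsetD)
qed

lemma simple_open_graph: "simple_graph G \<Longrightarrow> simple_graph (open_graph G \<omega>)"
  by (auto simp: simple_graph_def open_graph_def)

lemma degrees_open_graph: "degrees_at_most G \<Delta> \<Longrightarrow> degrees_at_most (open_graph G \<omega>) \<Delta>"
  by (erule degrees_at_most_subgraph) (auto simp: open_graph_def)

subsection \<open>Large components\<close>

text \<open>The infinite case is listed separately because \<open>card\<close> of an infinite set is
  0.\<close>

definition large_comp :: "nat \<Rightarrow> 'v graph \<Rightarrow> 'v \<Rightarrow> bool" where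
  "large_comp k H v \<longleftrightarrow> infinite (graph_component H v) \<or> k \<le> card (graph_component H v)"

text \<open>Balls of a graph grow strictly until they exhaust the component.\<close>

lemma large_comp_iff_nball:
  assumes "simple_graph H" "degrees_at_most H \<Delta>" "v \<in> verts H"
  shows "large_comp k H v \<longleftrightarrow> k \<le> card (nball H v k)"
proof
  assume L: "large_comp k H v"
  have C: "graph_component H v = (\<Union>j. nball H v j)"
    using assms by (simp add: graph_component_eq_Union_nball)
  show "k \<le> card (nball H v k)"
  proof (cases "\<exists>j<k. nball H v (Suc j) = nball H v j")
    case True
    then obtain j where j: "j < k" "nball H v (Suc j) = nball H v j" by blast
    have stab: "nball H v (j + i) = nball H v j" for i
    proof (induction i)
      case (Suc i)
      have "nball H v (j + Suc i) = nball H v (Suc j)"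
        by (simp only: add_Suc_right nball.simps Suc)
      then show ?case using j(2) by (rule trans)
    qed simp
    have "nball H v i \<subseteq> nball H v j" for i
      using stab[of "i - j"] nball_mono[of i "j + (i - j)" H v] by (simp del: nball.simps)
    then have "graph_component H v = nball H v k"
      using C nball_mono[of j k H v] j by auto
    then show ?thesis using L finite_nball[OF assms(1,2), of v k] by (auto simp: large_comp_def)
  next
    case False
    have "j \<le> k \<Longrightarrow> j + 1 \<le> card (nball H v j)" for j
    proof (induction j)
      case (Suc j)
      have "nball H v (Suc j) \<noteq> nball H v j" using False Suc.prems Suc_le_eq by blast
      then have "nball H v j \<subset> nball H v (Suc j)"
        by (intro psubsetI nball_mono) simp_all
      then have "card (nball H v j) < card (nball H v (Suc j))"
        using finite_nball[OF assms(1,2)] by (intro psubset_card_mono)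
      then show ?case using Suc by simp
    qed simp
    from this[of k] show ?thesis by simp
  qed
next
  assume "k \<le> card (nball H v k)"
  moreover have "nball H v k \<subseteq> graph_component H v"
    using assms by (auto simp: graph_component_eq_Union_nball)
  ultimately show "large_comp k H v" unfolding large_comp_def
    by (meson card_mono order_trans)
qed

lemma large_comp_antimono: "k \<le> l \<Longrightarrow> large_comp l H v \<Longrightarrow> large_comp k H v"
  by (auto simp: large_comp_def)

lemma infinite_comp_iff_large: "infinite (graph_component H v) \<longleftrightarrow> (\<forall>k. large_comp k H v)"
  unfolding large_comp_def by (metis Suc_n_not_le_n)

subsection \<open>Isomorphic balls\<close>

text \<open>Adjacency is compared on pairs of vertices instead of through images of edge sets: this
  is the form in which open subgraphs of two graphs, possibly over different vertex types, are
  matched later.\<close>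

definition ball_iso :: "nat \<Rightarrow> 'v graph \<Rightarrow> 'v \<Rightarrow> 'w graph \<Rightarrow> 'w \<Rightarrow> ('v \<Rightarrow> 'w) \<Rightarrow> bool" where
  "ball_iso k G v G' v' f \<longleftrightarrow> bij_betw f (nball G v k) (nball G' v' k) \<and> f v = v' \<and>
     (\<forall>x\<in>nball G v k. \<forall>y\<in>nball G v k. {x, y} \<in> edges G \<longleftrightarrow> {f x, f y} \<in> edges G')"

lemma nball_subgraph: "edges H \<subseteq> edges G \<Longrightarrow> nball H v j \<subseteq> nball G v j"
  by (induction j) auto

lemma image_nball:
  assumes "f v = v'"
    and S: "nball H v k \<subseteq> S" "nball H' v' k \<subseteq> f ` S"
    and eq: "\<And>x y. x \<in> S \<Longrightarrow> y \<in> S \<Longrightarrow> {x, y} \<in> edges H \<longleftrightarrow> {f x, f y} \<in> edges H'"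
    and "j \<le> k"
  shows "f ` nball H v j = nball H' v' j"
  using \<open>j \<le> k\<close>
proof (induction j)
  case 0
  then show ?case using assms by simp
next
  case (Suc j)
  have S: "nball H v (Suc j) \<subseteq> S" "nball H' v' (Suc j) \<subseteq> f ` S"
    using S nball_mono[OF Suc.prems] by (metis order_trans)+
  have IH: "f ` nball H v j = nball H' v' j" using Suc by simp
  show ?case
  proof (rule set_eqI)
    fix z
    have "z \<in> nball H' v' (Suc j)" if z: "z \<in> f ` nball H v (Suc j)"
    proof -
      obtain w where w: "z = f w" "w \<in> nball H v (Suc j)" using z by blast
      show ?thesis
      proof (cases "w \<in> nball H v j")
        case False
        then obtain u where u: "u \<in> nball H v j" "{u, w} \<in> edges H" using w by auto
        then have "{f u, f w} \<in> edges H'" using eq[of u w] w S by auto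
        then show ?thesis using u IH w by auto
      qed (use IH w in auto)
    qed
    moreover have "z \<in> f ` nball H v (Suc j)" if z: "z \<in> nball H' v' (Suc j)"
    proof (cases "z \<in> nball H' v' j")
      case False
      then obtain u' where u': "u' \<in> nball H' v' j" "{u', z} \<in> edges H'" using z by auto
      then obtain u where u: "u' = f u" "u \<in> nball H v j" using IH by auto
      obtain w where w: "z = f w" "w \<in> S" using z S by blast
      have "{u, w} \<in> edges H" using eq[of u w] u w u' S by auto
      then show ?thesis using u w by auto
    qed (use IH in auto)
    ultimately show "z \<in> f ` nball H v (Suc j) \<longleftrightarrow> z \<in> nball H' v' (Suc j)" by blast
  qed
qed

text \<open>Meant for open subgraphs: their balls lie inside the balls of the ambient graphs, so an
  isomorphism of the latter that respects open edges carries the former to each other.\<close>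

lemma ball_iso_image_nball:
  assumes iso: "ball_iso k G v G' v' f"
    and H: "edges H \<subseteq> edges G" "edges H' \<subseteq> edges G'"
    and eq: "\<And>x y. x \<in> nball G v k \<Longrightarrow> y \<in> nball G v k \<Longrightarrow>
        {x, y} \<in> edges H \<longleftrightarrow> {f x, f y} \<in> edges H'"
    and "j \<le> k"
  shows "f ` nball H v j = nball H' v' j"
proof (rule image_nball[OF _ _ _ eq \<open>j \<le> k\<close>])
  show "f v = v'" using iso by (simp add: ball_iso_def)
  show "nball H' v' k \<subseteq> f ` nball G v k"
    using iso nball_subgraph[OF H(2)] by (simp add: ball_iso_def bij_betw_def)
qed (use nball_subgraph[OF H(1)] in auto)

text \<open>Distances are natural numbers or infinite, so only the floor of \<open>r\<close>
  matters. As \<open>nat\<close> sends a negative floor to 0, the sign of \<open>r\<close> has to be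
  stated separately.\<close>

lemma graph_dist_le_iff: "ereal_of_enat (graph_dist G v w) \<le> ereal r \<longleftrightarrow>
    0 \<le> r \<and> w \<in> nball G v (nat \<lfloor>r\<rfloor>)"
proof (cases "\<exists>k. (v, w) \<in> adj G ^^ k")
  case True
  define m where "m = (LEAST k. (v, w) \<in> adj G ^^ k)"
  have m: "(v, w) \<in> adj G ^^ m" using True unfolding m_def by (auto intro: LeastI)
  have le: "m \<le> k" if "(v, w) \<in> adj G ^^ k" for k using that unfolding m_def by (rule Least_le)
  have "graph_dist G v w = enat m" unfolding graph_dist_def
    by (rule antisym) (use m le in \<open>auto intro!: INF_lower INF_greatest\<close>)
  moreover have "w \<in> nball G v j \<longleftrightarrow> m \<le> j" for j
    using m le by (force simp: nball_iff_relpow)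
  moreover have "real m \<le> r \<longleftrightarrow> 0 \<le> r \<and> m \<le> nat \<lfloor>r\<rfloor>" by linarith
  ultimately show ?thesis by simp
next
  case False
  then have "graph_dist G v w = \<infinity>" by (simp add: graph_dist_def top_enat_def)
  then show ?thesis using False by (simp add: nball_iff_relpow)
qed

lemma rooted_ball_eq:
  assumes "simple_graph G" "v \<in> verts G" "0 \<le> r"
  shows "rooted_ball (G, v) r = (induced_subgraph G (nball G v (nat \<lfloor>r\<rfloor>)), v)"
proof -
  have "{w \<in> verts G. ereal_of_enat (graph_dist G v w) \<le> ereal r} = nball G v (nat \<lfloor>r\<rfloor>)"
    using nball_subset_verts[OF assms(1,2)] assms(3) by (auto simp: graph_dist_le_iff)
  then show ?thesis by (simp add: rooted_ball_def)
qed

text \<open>In a simple graph an edge is a pair of vertices, so for a bijection between the balls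
  equality of the edge sets is the same as preserving and reflecting adjacency.\<close>

lemma rooted_ball_iso_iff:
  assumes "simple_graph G" "v \<in> verts G" "simple_graph G'" "v' \<in> verts G'" "0 \<le> r"
  shows "rooted_ball (G, v) r \<cong>\<^sub>r rooted_ball (G', v') r \<longleftrightarrow>
    (\<exists>f. ball_iso (nat \<lfloor>r\<rfloor>) G v G' v' f)"
proof -
  define k where "k = nat \<lfloor>r\<rfloor>"
  let ?S = "nball G v k" and ?S' = "nball G' v' k"
  have "((\<lambda>e. f ` e) ` {e \<in> edges G. e \<subseteq> ?S} = {e \<in> edges G'. e \<subseteq> ?S'}) \<longleftrightarrow>
      (\<forall>x\<in>?S. \<forall>y\<in>?S. {x, y} \<in> edges G \<longleftrightarrow> {f x, f y} \<in> edges G')" (is "?L \<longleftrightarrow> ?R")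
    if bij: "bij_betw f ?S ?S'" for f
  proof
    assume L: ?L
    show ?R
    proof (intro ballI iffI)
      fix x y assume xy: "x \<in> ?S" "y \<in> ?S"
      { assume "{x, y} \<in> edges G"
        then have "f ` {x, y} \<in> (\<lambda>e. f ` e) ` {e \<in> edges G. e \<subseteq> ?S}"
          using xy by (intro imageI) simp
        then have "f ` {x, y} \<in> {e \<in> edges G'. e \<subseteq> ?S'}" using L by simp
        then show "{f x, f y} \<in> edges G'" by simp }
      { assume "{f x, f y} \<in> edges G'"
        then have "f ` {x, y} \<in> {e \<in> edges G'. e \<subseteq> ?S'}" using xy bij_betw_imp_surj_on[OF bij] by simp blast
        then have "f ` {x, y} \<in> (\<lambda>e. f ` e) ` {e \<in> edges G. e \<subseteq> ?S}" using L by simp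
        then obtain e where e: "f ` {x, y} = f ` e" "e \<in> edges G" "e \<subseteq> ?S"
          by (elim imageE) simp
        then have "{x, y} = e" using xy inj_on_image_eq_iff[OF bij_betw_imp_inj_on[OF bij], of "{x, y}" e]
          by (simp del: image_insert)
        then show "{x, y} \<in> edges G" using e by simp }
    qed
  next
    assume R: ?R
    show ?L
    proof (intro subset_antisym subsetI)
      fix e' assume "e' \<in> (\<lambda>e. f ` e) ` {e \<in> edges G. e \<subseteq> ?S}"
      then obtain e where e: "e' = f ` e" "e \<in> edges G" "e \<subseteq> ?S" by auto
      then have "card e = 2" using assms(1) by (simp add: simple_graph_def)
      then obtain x y where "e = {x, y}" by (auto simp: card_2_iff)
      with e R have "x \<in> ?S" "y \<in> ?S" "e' = {f x, f y}" "{f x, f y} \<in> edges G'" by simp_all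
      then show "e' \<in> {e \<in> edges G'. e \<subseteq> ?S'}"
        using bij_betw_imp_surj_on[OF bij] by simp blast
    next
      fix e' assume "e' \<in> {e \<in> edges G'. e \<subseteq> ?S'}"
      then have e': "e' \<in> edges G'" "e' \<subseteq> ?S'" by auto
      then have "card e' = 2" using assms(3) by (simp add: simple_graph_def)
      then obtain x' y' where xy': "e' = {x', y'}" by (auto simp: card_2_iff)
      then obtain x y where "x \<in> ?S" "y \<in> ?S" "x' = f x" "y' = f y"
        using e'(2) unfolding xy' bij_betw_imp_surj_on[OF bij, symmetric] by auto
      then show "e' \<in> (\<lambda>e. f ` e) ` {e \<in> edges G. e \<subseteq> ?S}"
        using R e'(1) unfolding xy' by (intro image_eqI[of _ _ "{x, y}"]) simp_all
    qed
  qed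
  then have "(bij_betw f ?S ?S' \<and> (\<lambda>e. f ` e) ` {e \<in> edges G. e \<subseteq> ?S} = {e \<in> edges G'. e \<subseteq> ?S'} \<and> f v = v')
      \<longleftrightarrow> ball_iso k G v G' v' f" for f
    unfolding ball_iso_def by (cases "bij_betw f ?S ?S'") (simp_all add: conj_commute)
  then show ?thesis
    by (simp add: rooted_ball_eq[OF assms(1,2,5)] rooted_ball_eq[OF assms(3,4,5)]
        k_def[symmetric] rooted_iso_def induced_subgraph_def)
qed


lemma ball_iso_refl: "ball_iso k G v G v id"
  by (simp add: ball_iso_def)

lemma ball_iso_sym:
  assumes "ball_iso k G v G' v' f"
  shows "ball_iso k G' v' G v (inv_into (nball G v k) f)"
proof -
  have bij: "bij_betw f (nball G v k) (nball G' v' k)" and fv: "f v = v'"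
    using assms by (auto simp: ball_iso_def)
  define g where "g = inv_into (nball G v k) f"
  have g: "g x \<in> nball G v k \<and> f (g x) = x" if "x \<in> nball G' v' k" for x
    using bij that unfolding g_def by (metis bij_betw_imp_surj_on f_inv_into_f inv_into_into)
  have "g v' = v" using bij fv unfolding g_def by (auto simp: bij_betw_def)
  moreover have "bij_betw g (nball G' v' k) (nball G v k)" unfolding g_def
    using bij by (rule bij_betw_inv_into)
  moreover have "{x, y} \<in> edges G' \<longleftrightarrow> {g x, g y} \<in> edges G"
    if "x \<in> nball G' v' k" "y \<in> nball G' v' k" for x y
    using assms g[OF that(1)] g[OF that(2)] unfolding ball_iso_def by metis
  ultimately show ?thesis unfolding ball_iso_def g_def[symmetric] by blast
qed

lemma ball_iso_trans:
  assumes "ball_iso k G v G' v' f" "ball_iso k G' v' G'' v'' g"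
  shows "ball_iso k G v G'' v'' (g \<circ> f)"
proof -
  have "f x \<in> nball G' v' k" if "x \<in> nball G v k" for x
    using assms(1) that by (auto simp: ball_iso_def bij_betw_def)
  then show ?thesis
    using assms unfolding ball_iso_def by (auto intro: bij_betw_trans)
qed

lemma ball_iso_card_nball: "ball_iso k G v G' v' f \<Longrightarrow> card (nball G v k) = card (nball G' v' k)"
  unfolding ball_iso_def by (auto intro: bij_betw_same_card)

definition valid :: "nat \<Rightarrow> 'v graph \<Rightarrow> 'v \<Rightarrow> bool" where
  "valid \<Delta> G v \<longleftrightarrow> simple_graph G \<and> degrees_at_most G \<Delta> \<and> v \<in> verts G"

lemma connected_iff_Union_nball:
  assumes "simple_graph G" "v \<in> verts G"
  shows "connected_graph G \<longleftrightarrow> verts G = (\<Union>j. nball G v j)"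
proof
  assume "connected_graph G"
  then have "verts G \<subseteq> (\<Union>j. nball G v j)"
    using assms by (auto simp: connected_graph_def Union_nball)
  then show "verts G = (\<Union>j. nball G v j)"
    using nball_subset_verts[OF assms] by blast
next
  assume *: "verts G = (\<Union>j. nball G v j)"
  show "connected_graph G" unfolding connected_graph_def *[unfolded Union_nball]
    using adj_rtrancl_sym[of v _ G] by (metis mem_Collect_eq rtrancl_trans)
qed

subsection \<open>Finitely many isomorphism types of balls\<close>

text \<open>A finite catalogue of balls of radius \<open>k\<close>: by \<open>card_nball_le\<close>
  such a ball has at most \<open>Suc \<Delta> ^ k\<close> vertices and can be relabelled by the
  numbers below this bound.\<close>

definition ball_graphs :: "nat \<Rightarrow> nat \<Rightarrow> nat rooted set" where
  "ball_graphs \<Delta> k = {(H, h). valid \<Delta> H h \<and> verts H \<subseteq> {..< Suc \<Delta> ^ k} \<and> nball H h k = verts H}"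

lemma finite_ball_graphs: "finite (ball_graphs \<Delta> k)"
proof (rule finite_subset)
  show "ball_graphs \<Delta> k \<subseteq>
      (Pow {..< Suc \<Delta> ^ k} \<times> Pow (Pow {..< Suc \<Delta> ^ k})) \<times> {..< Suc \<Delta> ^ k}"
  proof
    fix x assume x: "x \<in> ball_graphs \<Delta> k"
    obtain V E h where xeq: "x = ((V, E), h)" by (metis surj_pair)
    from x have V: "V \<subseteq> {..< Suc \<Delta> ^ k}" and E: "\<forall>e\<in>E. e \<subseteq> V" and h: "h \<in> V"
      unfolding xeq by (simp_all add: ball_graphs_def valid_def simple_graph_def)
    have "E \<subseteq> Pow {..< Suc \<Delta> ^ k}" using V E by blast
    then show "x \<in> (Pow {..< Suc \<Delta> ^ k} \<times> Pow (Pow {..< Suc \<Delta> ^ k})) \<times> {..< Suc \<Delta> ^ k}"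
      using V h unfolding xeq by blast
  qed
qed simp

text \<open>Makes the catalogue admissible as test graphs in the definition of local weak
  convergence.\<close>

lemma ball_graphs_rooted:
  assumes "(H, h) \<in> ball_graphs \<Delta> k" shows "rooted_graph (H, h)" "finite (verts H)"
proof -
  have "verts H = (\<Union>j. nball H h j)"
    using assms nball_subset_verts[of H h] by (auto simp: ball_graphs_def valid_def)
  then show "rooted_graph (H, h)"
    using assms connected_iff_Union_nball[of H h]
    by (simp add: ball_graphs_def valid_def rooted_graph_def)
  show "finite (verts H)" using assms finite_subset by (auto simp: ball_graphs_def)
qed

text \<open>The ball is numbered and its edges are transported. Since the numbering is injective,
  the edges at a number come from edges at its vertex, which preserves the degree bound.\<close>

lemma ex_ball_graph:
  assumes "valid \<Delta> G v"
  shows "\<exists>H h f. (H, h) \<in> ball_graphs \<Delta> k \<and> ball_iso k G v H h f"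
proof -
  define S where "S = nball G v k"
  have G: "simple_graph G" "degrees_at_most G \<Delta>" "v \<in> verts G" using assms by (auto simp: valid_def)
  have fin: "finite S" "card S \<le> Suc \<Delta> ^ k"
    unfolding S_def using finite_nball[OF G(1,2)] card_nball_le[OF G(1,2)] by simp_all
  obtain f where f: "bij_betw f S {..<card S}"
    using fin(1) ex_bij_betw_finite_nat[of S] by (auto simp: lessThan_atLeast0)
  have inj: "inj_on f S" and im: "f ` S = {..<card S}" using f by (auto simp: bij_betw_def)
  define H where "H = ({..<card S}, (\<lambda>e. f ` e) ` {e \<in> edges G. e \<subseteq> S})"
  have VH: "verts H = {..<card S}" and EH: "edges H = (\<lambda>e. f ` e) ` {e \<in> edges G. e \<subseteq> S}"
    by (simp_all add: H_def)
  have vS: "v \<in> S" by (simp add: S_def)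
  have SV: "S \<subseteq> verts G" unfolding S_def using nball_subset_verts[OF G(1,3)] .
  have edge: "{x, y} \<in> edges G \<longleftrightarrow> {f x, f y} \<in> edges H" if "x \<in> S" "y \<in> S" for x y
  proof
    assume "{x, y} \<in> edges G"
    then show "{f x, f y} \<in> edges H" unfolding EH using that
      by (intro image_eqI[of _ _ "{x, y}"]) simp_all
  next
    assume "{f x, f y} \<in> edges H"
    then obtain e where e: "f ` {x, y} = f ` e" "e \<in> edges G" "e \<subseteq> S"
      unfolding EH by (elim imageE) simp
    then have "{x, y} = e" using that inj_on_image_eq_iff[OF inj, of "{x, y}" e]
      by (simp del: image_insert)
    then show "{x, y} \<in> edges G" using e by simp
  qed
  have simp: "simple_graph H" unfolding simple_graph_def
  proof (intro ballI conjI)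
    fix e' assume "e' \<in> edges H"
    then obtain e where e: "e' = f ` e" "e \<in> edges G" "e \<subseteq> S" unfolding EH by blast
    then show "e' \<subseteq> verts H" using im VH by auto
    have "card e = 2" using e G by (simp add: simple_graph_def)
    then show "card e' = 2" using e inj by (metis card_image inj_on_subset)
  qed
  have deg: "degrees_at_most H \<Delta>" unfolding degrees_at_most_def
  proof
    fix x assume "x \<in> verts H"
    then obtain u where u: "x = f u" "u \<in> S" using VH im by blast
    have sub: "{e \<in> edges H. x \<in> e} \<subseteq> (\<lambda>e. f ` e) ` {e \<in> edges G. u \<in> e}"
    proof
      fix e' assume "e' \<in> {e \<in> edges H. x \<in> e}"
      then obtain e where e: "e' = f ` e" "e \<in> edges G" "e \<subseteq> S" "f u \<in> f ` e"
        unfolding EH u by blast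
      then have "u \<in> e" using inj_on_image_mem_iff[OF inj u(2)] by blast
      then show "e' \<in> (\<lambda>e. f ` e) ` {e \<in> edges G. u \<in> e}" using e by blast
    qed
    have "finite {e \<in> edges G. u \<in> e}" "card {e \<in> edges G. u \<in> e} \<le> \<Delta>"
      using G u SV by (auto simp: degrees_at_most_def)
    then show "finite {e \<in> edges H. x \<in> e} \<and> card {e \<in> edges H. x \<in> e} \<le> \<Delta>"
      using sub by (meson card_image_le card_mono finite_imageI finite_subset le_trans)
  qed
  have fv: "f v \<in> verts H" using vS im VH by blast
  have "f ` nball G v k = nball H (f v) k"
    by (rule image_nball[where S = S and k = k])
      (use edge nball_subset_verts[OF simp fv, of k] VH im in \<open>simp_all add: S_def\<close>)
  then have nb: "nball H (f v) k = verts H" using im VH by (simp add: S_def)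
  have "(H, f v) \<in> ball_graphs \<Delta> k"
    using simp deg fv nb fin(2) VH by (auto simp: ball_graphs_def valid_def)
  moreover have "ball_iso k G v H (f v) f" unfolding ball_iso_def S_def[symmetric] nb
    using f edge VH by auto
  ultimately show ?thesis by blast
qed

text \<open>The condition under \<open>SOME\<close> depends on the ball only up to isomorphism.
  Isomorphic balls thus receive the very same representative, even over different vertex
  types.\<close>

definition ball_type :: "nat \<Rightarrow> nat \<Rightarrow> 'v graph \<Rightarrow> 'v \<Rightarrow> nat rooted" where
  "ball_type \<Delta> k G v =
     (SOME (H, h). (H, h) \<in> ball_graphs \<Delta> k \<and> (\<exists>f. ball_iso k G v H h f))"

lemma ball_type:
  assumes "valid \<Delta> G v" "ball_type \<Delta> k G v = (H, h)"
  shows "(H, h) \<in> ball_graphs \<Delta> k" "\<exists>f. ball_iso k G v H h f"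
proof -
  have "\<exists>x. case x of (H, h) \<Rightarrow> (H, h) \<in> ball_graphs \<Delta> k \<and> (\<exists>f. ball_iso k G v H h f)"
    using ex_ball_graph[OF assms(1), of k] by auto
  from someI_ex[OF this]
  show "(H, h) \<in> ball_graphs \<Delta> k" "\<exists>f. ball_iso k G v H h f"
    using assms(2) unfolding ball_type_def by auto
qed

lemma ball_type_eq:
  assumes "ball_iso k G v G' v' f"
  shows "ball_type \<Delta> k G v = ball_type \<Delta> k G' v'"
proof -
  have "(\<exists>g. ball_iso k G v H h g) \<longleftrightarrow> (\<exists>g. ball_iso k G' v' H h g)" for H :: "nat graph" and h
    using ball_iso_trans[OF assms, of H h] ball_iso_trans[OF ball_iso_sym[OF assms], of H h] by metis
  then show ?thesis by (simp add: ball_type_def)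
qed

text \<open>\<open>(H, h)\<close> has to be a chosen representative: another member of
  \<open>ball_graphs\<close> could be isomorphic to the ball without being its type. Since
  \<open>H\<close> is its own ball of radius \<open>k\<close>, comparing with \<open>H\<close>
  amounts to comparing with a ball.\<close>

lemma ball_type_eq_iff:
  assumes "valid \<Delta> G v" "valid \<Delta> G' v'" "(H, h) = ball_type \<Delta> k G' v'" "0 \<le> r" "nat \<lfloor>r\<rfloor> = k"
  shows "ball_type \<Delta> k G v = (H, h) \<longleftrightarrow> rooted_ball (G, v) r \<cong>\<^sub>r (H, h)"
proof -
  have H: "(H, h) \<in> ball_graphs \<Delta> k" "\<exists>f. ball_iso k G' v' H h f"
    using ball_type[OF assms(2) assms(3)[symmetric]] by simp_all
  then have val: "simple_graph H" "h \<in> verts H" "nball H h k = verts H"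
    by (auto simp: ball_graphs_def valid_def)
  then have "rooted_ball (H, h) r = (induced_subgraph H (verts H), h)"
    using assms(4,5) rooted_ball_eq[of H h r] by simp
  moreover have "induced_subgraph H (verts H) = H"
    using val(1) by (auto simp: induced_subgraph_def simple_graph_def prod_eq_iff)
  ultimately have "rooted_ball (H, h) r = (H, h)" by simp
  then have "rooted_ball (G, v) r \<cong>\<^sub>r (H, h) \<longleftrightarrow> (\<exists>f. ball_iso k G v H h f)"
    using rooted_ball_iso_iff[of G v H h r] val assms(1,4,5) by (simp add: valid_def)
  also have "\<dots> \<longleftrightarrow> ball_type \<Delta> k G v = (H, h)"
  proof
    assume "\<exists>f. ball_iso k G v H h f"
    then obtain f g where "ball_iso k G v H h f" "ball_iso k G' v' H h g" using H by blast
    then show "ball_type \<Delta> k G v = (H, h)" unfolding assms(3) using ball_type_eq by metis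
  next
    assume "ball_type \<Delta> k G v = (H, h)"
    then show "\<exists>f. ball_iso k G v H h f" using ball_type[OF assms(1)] by simp
  qed
  finally show ?thesis ..
qed


subsection \<open>The space of rooted graphs\<close>

lemma rooted_iso_refl: "x \<cong>\<^sub>r x"
  unfolding rooted_iso_def by (cases x) (auto intro!: exI[of _ id])

lemma rep_in_rooted_graphs:
  assumes "X \<in> graph_space \<Delta>" shows "rep X \<in> rooted_graphs \<Delta>"
proof -
  obtain x where x: "x \<in> rooted_graphs \<Delta>"
      "X = {(x, y). x \<in> rooted_graphs \<Delta> \<and> y \<in> rooted_graphs \<Delta> \<and> x \<cong>\<^sub>r y} `` {x}"
    using assms unfolding graph_space_def by (rule quotientE)
  then have "x \<in> X" using rooted_iso_refl by blast
  then have "rep X \<in> X" unfolding rep_def by (rule someI)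
  then show ?thesis using x by blast
qed

lemma rep_valid:
  assumes "X \<in> graph_space \<Delta>"
  shows "valid \<Delta> (fst (rep X)) (snd (rep X))" "connected_graph (fst (rep X))"
  using rep_in_rooted_graphs[OF assms]
  by (auto simp: rooted_graphs_def rooted_graph_def valid_def split: prod.splits)

lemma space_random_rooted_graph: "random_rooted_graph \<Delta> \<mu> \<Longrightarrow> space \<mu> = graph_space \<Delta>"
  using sets_eq_imp_space_eq[of \<mu> "graph_borel \<Delta>"]
  by (auto simp: random_rooted_graph_def graph_borel_def space_measure_of_conv)

text \<open>\<open>ball_graphs\<close> may hold several labelled copies of one ball. Keeping only
  the chosen ones makes the type equal to \<open>H\<close> exactly when the ball is isomorphic to
  \<open>H\<close>.\<close>

definition ball_types :: "nat \<Rightarrow> nat \<Rightarrow> nat rooted set" where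
  "ball_types \<Delta> k = {ball_type \<Delta> k H h | (H :: nat graph) h. valid \<Delta> H h}"

lemma ball_types_subset: "ball_types \<Delta> k \<subseteq> ball_graphs \<Delta> k"
proof
  fix x assume "x \<in> ball_types \<Delta> k"
  then obtain H :: "nat graph" and h where "x = ball_type \<Delta> k H h" "valid \<Delta> H h"
    unfolding ball_types_def by blast
  then show "x \<in> ball_graphs \<Delta> k" using ball_type(1)[of \<Delta> H h k "fst x" "snd x"] by simp
qed

lemma finite_ball_types: "finite (ball_types \<Delta> k)"
  using finite_subset[OF ball_types_subset finite_ball_graphs] .

text \<open>The representative is itself a graph on numbers with the same type, so types of graphs
  over any vertex type are covered.\<close>

lemma ball_type_mem:
  assumes "valid \<Delta> G v" shows "ball_type \<Delta> k G v \<in> ball_types \<Delta> k"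
proof -
  obtain H h where H: "ball_type \<Delta> k G v = (H, h)" by fastforce
  have v: "valid \<Delta> H h" using ball_type(1)[OF assms H] by (simp add: ball_graphs_def)
  obtain f where "ball_iso k G v H h f" using ball_type(2)[OF assms H] by blast
  from ball_type_eq[OF this, of \<Delta>] v show ?thesis unfolding ball_types_def by blast
qed

lemma ball_type_iff:
  assumes "valid \<Delta> K v" "H \<in> ball_types \<Delta> k"
  shows "ball_type \<Delta> k K v = H \<longleftrightarrow> rooted_ball (K, v) (real k) \<cong>\<^sub>r H"
proof -
  obtain K' :: "nat graph" and v' where "H = ball_type \<Delta> k K' v'" "valid \<Delta> K' v'"
    using assms(2) unfolding ball_types_def by blast
  then show ?thesis
    using ball_type_eq_iff[OF assms(1), of K' v' "fst H" "snd H" k "real k"] by simp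
qed

text \<open>No measurability of the ball events in the Borel field of the metric is needed: their
  probabilities sum to one, being limits of probabilities that do, so the events that are not
  measurable (whose \<^const>\<open>measure\<close> is 0) lie in a null set.\<close>

lemma local_limit:
  fixes G :: "nat \<Rightarrow> 'v graph" and F :: "'v graph \<Rightarrow> 'v \<Rightarrow> real" and F' :: "nat graph \<Rightarrow> nat \<Rightarrow> real"
  assumes \<mu>: "random_rooted_graph \<Delta> \<mu>" and conv: "locally_weakly_converges G \<mu>" and k: "0 < k"
    and G: "\<And>n. n \<ge> 1 \<Longrightarrow> finite_graph (G n)" "\<And>n. n \<ge> 1 \<Longrightarrow> degrees_at_most (G n) \<Delta>"
    and FF': "\<And>H v H' v' f. valid \<Delta> H v \<Longrightarrow> valid \<Delta> H' v' \<Longrightarrow> ball_iso k H v H' v' f \<Longrightarrow> F H v = F' H' v'"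
    and F'F': "\<And>H v H' v' f. valid \<Delta> H v \<Longrightarrow> valid \<Delta> H' v' \<Longrightarrow> ball_iso k H v H' v' f \<Longrightarrow> F' H v = F' H' v'"
  obtains Ft where "Ft \<in> borel_measurable \<mu>" "integrable \<mu> Ft"
    "AE X in \<mu>. Ft X = F' (fst (rep X)) (snd (rep X))"
    "(\<lambda>n. (\<Sum>v\<in>verts (G n). F (G n) v) / card (verts (G n))) \<longlonglongrightarrow> integral\<^sup>L \<mu> Ft"
proof -
  interpret prob_space \<mu> using \<mu> by (simp add: random_rooted_graph_def)
  have space: "space \<mu> = graph_space \<Delta>" using \<mu> by (rule space_random_rooted_graph)
  define \<B> where "\<B> = ball_types \<Delta> k"
  have fin: "finite \<B>" by (simp add: \<B>_def finite_ball_types)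
  define T where "T = (\<lambda>H. {X \<in> space \<mu>. ball_type \<Delta> k (fst (rep X)) (snd (rep X)) = H})"
  define P where "P = (\<lambda>n (H :: nat rooted). measure (measure_pmf (pmf_of_set (verts (G n)))) {u. rooted_ball (G n, u) (real k) \<cong>\<^sub>r H})"
  have val: "valid \<Delta> (G n) v" if "n \<ge> 1" "v \<in> verts (G n)" for n v
    using G that by (simp add: valid_def finite_graph_def)
  have lim: "(\<lambda>n. P n H) \<longlonglongrightarrow> measure \<mu> (T H)" if H: "H \<in> \<B>" for H
  proof -
    have "rooted_graph H \<and> finite (verts (fst H))"
      using H ball_types_subset[of \<Delta> k] ball_graphs_rooted[of "fst H" "snd H" \<Delta> k] by (auto simp: \<B>_def)
    then have "(\<lambda>n. P n H) \<longlonglongrightarrow> measure \<mu> {X \<in> space \<mu>. rooted_ball (rep X) (real k) \<cong>\<^sub>r H}"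
      using conv[unfolded locally_weakly_converges_def, rule_format, of "real k" H] k
      unfolding P_def by simp
    moreover have "{X \<in> space \<mu>. rooted_ball (rep X) (real k) \<cong>\<^sub>r H} = T H"
      unfolding T_def using ball_type_iff[OF rep_valid(1) H[unfolded \<B>_def]] by (auto simp: space)
    ultimately show ?thesis by simp
  qed
  \<comment> \<open>Grouping the vertices by type turns an average of a local function into a finite
    combination of the probabilities that converge by hypothesis.\<close>
  have avg: "(\<Sum>v\<in>verts (G n). f (ball_type \<Delta> k (G n) v)) / card (verts (G n)) = (\<Sum>H\<in>\<B>. f H * P n H)"
    if n: "n \<ge> 1" for n and f :: "nat rooted \<Rightarrow> real"
  proof -
    let ?V = "verts (G n)"
    have V: "finite ?V" "?V \<noteq> {}" using G[OF n] by (auto simp: finite_graph_def)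
    have "P n H = card {v \<in> ?V. ball_type \<Delta> k (G n) v = H} / card ?V" if "H \<in> \<B>" for H
    proof -
      have "?V \<inter> {u. rooted_ball (G n, u) (real k) \<cong>\<^sub>r H} = {v \<in> ?V. ball_type \<Delta> k (G n) v = H}"
        using ball_type_iff[OF val[OF n] that[unfolded \<B>_def]] by auto
      then show ?thesis using V by (simp add: P_def measure_pmf_of_set)
    qed
    then have "(\<Sum>H\<in>\<B>. f H * P n H) = (\<Sum>H\<in>\<B>. f H * card {v \<in> ?V. ball_type \<Delta> k (G n) v = H}) / card ?V"
      by (simp add: sum_divide_distrib)
    also have "(\<Sum>H\<in>\<B>. f H * card {v \<in> ?V. ball_type \<Delta> k (G n) v = H})
        = (\<Sum>H\<in>\<B>. \<Sum>v\<in>{v \<in> ?V. ball_type \<Delta> k (G n) v = H}. f (ball_type \<Delta> k (G n) v))"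
      by (intro sum.cong refl) simp
    also have "\<dots> = (\<Sum>v\<in>?V. f (ball_type \<Delta> k (G n) v))"
      using V fin ball_type_mem[OF val[OF n]] by (intro sum.group) (auto simp: \<B>_def)
    finally show ?thesis by simp
  qed
  \<comment> \<open>The factor 1 brings the total mass into the shape of \<open>avg\<close> with a
    constant weight.\<close>
  have "(\<lambda>n. \<Sum>H\<in>\<B>. 1 * P n H) \<longlonglongrightarrow> (\<Sum>H\<in>\<B>. 1 * measure \<mu> (T H))"
    by (intro tendsto_intros lim)
  moreover have "(\<Sum>H\<in>\<B>. 1 * P n H) = 1" if n: "n \<ge> 1" for n
    using avg[OF n, of "\<lambda>_. 1"] G[OF n] by (simp add: finite_graph_def)
  then have "(\<lambda>n. \<Sum>H\<in>\<B>. 1 * P n H) \<longlonglongrightarrow> 1"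
    by (intro tendsto_eventually eventually_sequentiallyI)
  ultimately have total: "(\<Sum>H\<in>\<B>. measure \<mu> (T H)) = 1"
    using LIMSEQ_unique by fastforce
  define \<B>' where "\<B>' = {H \<in> \<B>. T H \<in> sets \<mu>}"
  have fin': "finite \<B>'" using fin by (simp add: \<B>'_def)
  have "(\<Sum>H\<in>\<B>'. measure \<mu> (T H)) = (\<Sum>H\<in>\<B>. measure \<mu> (T H))"
    using fin by (intro sum.mono_neutral_left) (auto simp: \<B>'_def measure_notin_sets)
  moreover have "(\<Sum>H\<in>\<B>'. measure \<mu> (T H)) = measure \<mu> (\<Union>H\<in>\<B>'. T H)"
    using fin' by (intro finite_measure_finite_Union[symmetric])
      (auto simp: \<B>'_def disjoint_family_on_def T_def)
  ultimately have "prob (\<Union>H\<in>\<B>'. T H) = 1" using total by simp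
  then have AE: "AE X in \<mu>. X \<in> (\<Union>H\<in>\<B>'. T H)"
    using fin' by (subst (asm) prob_eq_1) (auto simp: \<B>'_def)
  \<comment> \<open>A simple function over the measurable types only: a measurable version of
    \<open>F'\<close> at the root.\<close>
  define Ft where "Ft = (\<lambda>X. \<Sum>H\<in>\<B>'. F' (fst H) (snd H) * indicator (T H) X)"
  have F'H: "F' K v = F' (fst H) (snd H)" if v: "valid \<Delta> K v" and bt: "ball_type \<Delta> k K v = H" for K v H
  proof -
    have H: "ball_type \<Delta> k K v = (fst H, snd H)" using bt by simp
    obtain f where "ball_iso k K v (fst H) (snd H) f" using ball_type(2)[OF v H] by blast
    moreover have "valid \<Delta> (fst H) (snd H)" using ball_type(1)[OF v H] by (simp add: ball_graphs_def case_prod_beta)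
    ultimately show ?thesis using F'F'[OF v] by blast
  qed
  \<comment> \<open>\<open>F\<close> and \<open>F'\<close> stand for one function at two vertex
    types, since a variable cannot be used polymorphically. The representatives live over
    \<open>nat\<close>, where the two meet.\<close>
  have FH: "F K v = F' (fst H) (snd H)" if v: "valid \<Delta> K v" and bt: "ball_type \<Delta> k K v = H" for K v H
  proof -
    have H: "ball_type \<Delta> k K v = (fst H, snd H)" using bt by simp
    obtain f where "ball_iso k K v (fst H) (snd H) f" using ball_type(2)[OF v H] by blast
    moreover have "valid \<Delta> (fst H) (snd H)" using ball_type(1)[OF v H] by (simp add: ball_graphs_def case_prod_beta)
    ultimately show ?thesis using FF'[OF v] by blast
  qed
  have meas: "Ft \<in> borel_measurable \<mu>" unfolding Ft_def
    by (intro borel_measurable_sum borel_measurable_times borel_measurable_const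
        borel_measurable_indicator) (auto simp: \<B>'_def)
  have int: "integrable \<mu> Ft" unfolding Ft_def
    by (intro Bochner_Integration.integrable_sum integrable_mult_right integrable_real_indicator)
      (auto simp: \<B>'_def less_top[symmetric])
  have Ft_eq: "Ft X = F' (fst (rep X)) (snd (rep X))" if X: "X \<in> (\<Union>H\<in>\<B>'. T H)" for X
  proof -
    obtain H where H: "H \<in> \<B>'" "X \<in> T H" using X by blast
    have "Ft X = (\<Sum>H'\<in>\<B>'. if H' = H then F' (fst H) (snd H) else 0)"
      unfolding Ft_def using H by (intro sum.cong refl) (auto simp: T_def indicator_def)
    also have "\<dots> = F' (fst H) (snd H)" using H fin' by simp
    also have "\<dots> = F' (fst (rep X)) (snd (rep X))"
      using F'H[OF rep_valid(1)] H(2) by (simp add: T_def space)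
    finally show ?thesis .
  qed
  have "integral\<^sup>L \<mu> Ft = (\<Sum>H\<in>\<B>'. F' (fst H) (snd H) * measure \<mu> (T H))"
    unfolding Ft_def
    by (subst Bochner_Integration.integral_sum)
      (auto simp: \<B>'_def less_top[symmetric] intro!: sum.cong)
  also have "\<dots> = (\<Sum>H\<in>\<B>. F' (fst H) (snd H) * measure \<mu> (T H))"
    using fin by (intro sum.mono_neutral_left) (auto simp: \<B>'_def measure_notin_sets)
  finally have "integral\<^sup>L \<mu> Ft = (\<Sum>H\<in>\<B>. F' (fst H) (snd H) * measure \<mu> (T H))" .
  then have "(\<lambda>n. \<Sum>H\<in>\<B>. F' (fst H) (snd H) * P n H) \<longlonglongrightarrow> integral\<^sup>L \<mu> Ft"
    by (simp only:) (intro tendsto_sum tendsto_mult tendsto_const lim)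
  moreover have "(\<Sum>v\<in>verts (G n). F (G n) v) / card (verts (G n)) = (\<Sum>H\<in>\<B>. F' (fst H) (snd H) * P n H)"
    if n: "n \<ge> 1" for n
    using avg[OF n, of "\<lambda>H. F' (fst H) (snd H)"] FH[OF val[OF n] refl] by simp
  then have "\<forall>\<^sub>F n in sequentially. (\<Sum>H\<in>\<B>. F' (fst H) (snd H) * P n H)
      = (\<Sum>v\<in>verts (G n). F (G n) v) / card (verts (G n))"
    by (intro eventually_sequentiallyI[of 1]) simp
  ultimately have "(\<lambda>n. (\<Sum>v\<in>verts (G n). F (G n) v) / card (verts (G n))) \<longlonglongrightarrow> integral\<^sup>L \<mu> Ft"
    by (rule Lim_transform_eventually)
  moreover from AE have "AE X in \<mu>. Ft X = F' (fst (rep X)) (snd (rep X))"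
    by eventually_elim (rule Ft_eq)
  ultimately show thesis using that[OF meas int] by blast
qed


subsection \<open>Bernoulli product measures\<close>

abbreviation bern :: "real \<Rightarrow> bool measure" where
  "bern p \<equiv> measure_pmf (bernoulli_pmf p)"

lemma prob_space_bern_PiM: "prob_space (PiM I (\<lambda>_. bern p))"
  by (intro prob_space_PiM prob_space_measure_pmf)

lemma prob_space_percolation: "prob_space (percolation G p)"
  unfolding percolation_def by (rule prob_space_bern_PiM)

lemma space_percolation: "space (percolation G p) = extensional (edges G)"
  by (auto simp: percolation_def space_PiM PiE_def)

lemma emeasure_bern:
  assumes "0 \<le> p" "p \<le> 1"
  shows "emeasure (bern p) A = ennreal (of_bool (True \<in> A) * p + of_bool (False \<in> A) * (1 - p))"
proof -
  have "emeasure (bern p) A = (\<integral>\<^sup>+x. indicator A x \<partial>bern p)" by simp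
  also have "\<dots> = indicator A True * ennreal p + indicator A False * ennreal (1 - p)"
    using assms by (subst nn_integral_bernoulli_pmf) (auto)
  also have "\<dots> = ennreal (of_bool (True \<in> A) * p + of_bool (False \<in> A) * (1 - p))"
    using assms by (auto simp: indicator_def simp flip: ennreal_plus)
  finally show ?thesis .
qed

lemma sets_bern_PiM_finite:
  assumes "finite I"
  shows "sets (PiM I (\<lambda>_. bern p)) = Pow (extensional I)"
proof -
  have "sets (PiM I (\<lambda>_. bern p)) = sets (PiM I (\<lambda>_. count_space (UNIV :: bool set)))"
    by (intro sets_PiM_cong) simp_all
  also have "\<dots> = Pow (extensional I)"
    using assms by (subst count_space_PiM_finite) (auto simp: PiE_def)
  finally show ?thesis .
qed

text \<open>The joint law of the coordinates is the product measure itself, hence the product of its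
  marginals. The criterion needs a nonempty index set; for an empty one independence is
  vacuous.\<close>

lemma indep_coordinates:
  "prob_space.indep_vars (PiM I (\<lambda>_. bern p)) (\<lambda>_. bern p) (\<lambda>i \<omega>. \<omega> i) I"
proof -
  interpret product_prob_space "\<lambda>_. bern p" I by unfold_locales
  have comp: "distr (PiM I (\<lambda>_. bern p)) (bern p) (\<lambda>\<omega>. \<omega> i) = bern p" if "i \<in> I" for i
    using PiM_component[OF that] .
  have "distr (PiM I (\<lambda>_. bern p)) (PiM I (\<lambda>_. bern p)) (\<lambda>\<omega>. restrict (\<lambda>i. \<omega> i) I)
      = distr (PiM I (\<lambda>_. bern p)) (PiM I (\<lambda>_. bern p)) (\<lambda>\<omega>. \<omega>)"
    by (intro distr_cong) (auto simp: space_PiM PiE_def extensional_restrict)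
  also have "\<dots> = PiM I (\<lambda>i. distr (PiM I (\<lambda>_. bern p)) (bern p) (\<lambda>\<omega>. \<omega> i))"
    unfolding distr_id using comp by (intro PiM_cong) simp_all
  finally have distr: "distr (PiM I (\<lambda>_. bern p)) (PiM I (\<lambda>_. bern p)) (\<lambda>\<omega>. restrict (\<lambda>i. \<omega> i) I)
      = PiM I (\<lambda>i. distr (PiM I (\<lambda>_. bern p)) (bern p) (\<lambda>\<omega>. \<omega> i))" .
  show ?thesis
  proof (cases "I = {}")
    case True
    then have no: "i \<in> I \<longleftrightarrow> False" "J \<subseteq> I \<and> J \<noteq> {} \<longleftrightarrow> False" for i J by auto
    show ?thesis unfolding P.indep_vars_def P.indep_sets_def using no by blast
  next
    case False
    have "(\<lambda>\<omega>. \<omega> i) \<in> PiM I (\<lambda>_. bern p) \<rightarrow>\<^sub>M bern p" if "i \<in> I" for i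
      using measurable_component_singleton[OF that, of "\<lambda>_. bern p"] .
    from P.indep_vars_iff_distr_eq_PiM'[OF False this] show ?thesis using distr by simp
  qed
qed

lemma measurable_bern_union:
  "(\<lambda>(x, y). \<lambda>e\<in>I. x e \<or> y e) \<in>
    PiM I (\<lambda>_. bern a) \<Otimes>\<^sub>M PiM I (\<lambda>_. bern b) \<rightarrow>\<^sub>M PiM I (\<lambda>_. bern p)" (is "_ \<in> ?A \<Otimes>\<^sub>M ?B \<rightarrow>\<^sub>M _")
proof -
  have "(\<lambda>z. (fst z) e \<or> (snd z) e) \<in> ?A \<Otimes>\<^sub>M ?B \<rightarrow>\<^sub>M count_space UNIV" if "e \<in> I" for e
  proof -
    have [measurable]: "(\<lambda>z. (fst z) e) \<in> ?A \<Otimes>\<^sub>M ?B \<rightarrow>\<^sub>M count_space UNIV"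
        "(\<lambda>z. (snd z) e) \<in> ?A \<Otimes>\<^sub>M ?B \<rightarrow>\<^sub>M count_space UNIV"
      using measurable_component_singleton[OF that, of "\<lambda>_. bern a"]
        measurable_component_singleton[OF that, of "\<lambda>_. bern b"]
      by (auto intro!: measurable_compose[OF measurable_fst] measurable_compose[OF measurable_snd]
          cong: measurable_cong_sets)
    show ?thesis by measurable
  qed
  then show ?thesis unfolding case_prod_unfold
    by (intro measurable_restrict) (simp cong: measurable_cong_sets)
qed

text \<open>Cylinders determine the product measure. For fixed \<open>x\<close> the section of a
  cylinder is a cylinder in \<open>y\<close>, so its probability factors over coordinates; on one
  coordinate the identity is \<open>1 - p = (1 - a) * (1 - b)\<close>.\<close>

lemma bern_PiM_sprinkle:
  fixes a b p :: real
  assumes ab: "0 \<le> a" "a \<le> 1" "0 \<le> b" "b \<le> 1" and p: "p = a + (1 - a) * b"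
  shows "distr (PiM I (\<lambda>_. bern a) \<Otimes>\<^sub>M PiM I (\<lambda>_. bern b)) (PiM I (\<lambda>_. bern p))
    (\<lambda>(x, y). \<lambda>e\<in>I. x e \<or> y e) = PiM I (\<lambda>_. bern p)" (is "distr (?A \<Otimes>\<^sub>M ?B) ?P ?t = _")
proof -
  interpret P: product_prob_space "\<lambda>_. bern p" I by unfold_locales
  interpret A: product_prob_space "\<lambda>_. bern a" I by unfold_locales
  interpret B: product_prob_space "\<lambda>_. bern b" I by unfold_locales
  have "p = 1 - (1 - a) * (1 - b)" by (simp add: p algebra_simps)
  moreover have "0 \<le> (1 - a) * (1 - b)" "(1 - a) * (1 - b) \<le> 1"
    using ab by (simp_all add: mult_le_one)
  ultimately have p01: "0 \<le> p" "p \<le> 1" by linarith+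
  note [measurable] = measurable_bern_union[of I a b p]
  show ?thesis
  proof (rule P.PiM_eq)
    fix J :: "'a set" and F :: "'a \<Rightarrow> bool set"
    assume J: "finite J" "J \<subseteq> I"
    \<comment> \<open>The conditional probability of the constraint at \<open>j\<close>, given state
      \<open>s\<close> in the first configuration.\<close>
    define h where "h = (\<lambda>j s. emeasure (bern b) {t. (s \<or> t) \<in> F j})"
    let ?E = "prod_emb I (\<lambda>_. bern p) J (\<Pi>\<^sub>E j\<in>J. F j)"
    have E: "?E \<in> sets ?P" using J by (intro sets_PiM_I) auto
    have E_eq: "?E = {\<omega> \<in> extensional I. \<forall>j\<in>J. \<omega> j \<in> F j}"
      using J by (auto simp: prod_emb_def space_PiM PiE_def Pi_iff)
    have "emeasure (distr (?A \<Otimes>\<^sub>M ?B) ?P ?t) ?E = emeasure (?A \<Otimes>\<^sub>M ?B) (?t -` ?E \<inter> space (?A \<Otimes>\<^sub>M ?B))"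
      using E by (intro emeasure_distr) simp_all
    also have "\<dots> = (\<integral>\<^sup>+x. emeasure ?B (Pair x -` (?t -` ?E \<inter> space (?A \<Otimes>\<^sub>M ?B))) \<partial>?A)"
      using E by (intro B.P.emeasure_pair_measure_alt measurable_sets[of ?t _ ?P]) simp_all
    also have "\<dots> = (\<integral>\<^sup>+x. (\<Prod>j\<in>J. h j (x j)) \<partial>?A)"
    proof (intro nn_integral_cong)
      fix x assume x: "x \<in> space ?A"
      have "Pair x -` (?t -` ?E \<inter> space (?A \<Otimes>\<^sub>M ?B)) =
          {y \<in> space ?B. \<forall>j\<in>J. y j \<in> {t. (x j \<or> t) \<in> F j}}"
        using x J by (auto simp: E_eq space_pair_measure subset_iff)
      then show "emeasure ?B (Pair x -` (?t -` ?E \<inter> space (?A \<Otimes>\<^sub>M ?B))) = (\<Prod>j\<in>J. h j (x j))"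
        using B.emeasure_PiM_Collect[OF J(2,1), of "\<lambda>j. {t. (x j \<or> t) \<in> F j}"] by (simp add: h_def)
    qed
    also have "\<dots> = (\<Prod>j\<in>J. \<integral>\<^sup>+x. h j (x j) \<partial>?A)"
    proof (rule A.P.indep_vars_nn_integral[OF J(1)])
      have "A.P.indep_vars (\<lambda>_. bern a) (\<lambda>i \<omega>. \<omega> i) J"
        using indep_coordinates J(2) A.P.indep_vars_subset by blast
      then show "A.P.indep_vars (\<lambda>_. borel) (\<lambda>j x. h j (x j)) J"
        by (rule A.P.indep_vars_compose2) simp
    qed simp
    also have "\<dots> = (\<Prod>j\<in>J. emeasure (bern p) (F j))"
    proof (intro prod.cong refl)
      fix j assume "j \<in> J"
      then have j: "j \<in> I" using J by blast
      have "(\<integral>\<^sup>+x. h j (x j) \<partial>?A) = (\<integral>\<^sup>+s. h j s \<partial>distr ?A (bern a) (\<lambda>x. x j))"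
        using measurable_component_singleton[OF j, of "\<lambda>_. bern a"]
        by (intro nn_integral_distr[symmetric]) simp_all
      also have "\<dots> = (\<integral>\<^sup>+s. h j s \<partial>bern a)" using A.PiM_component[OF j] by simp
      also have "\<dots> = h j True * ennreal a + h j False * ennreal (1 - a)"
        using ab by (subst nn_integral_bernoulli_pmf) auto
      also have "\<dots> = emeasure (bern p) (F j)"
        using ab p01 unfolding h_def emeasure_bern[OF ab(3,4)] emeasure_bern[OF p01]
        by (simp flip: ennreal_plus ennreal_mult'')
          (auto simp: p algebra_simps)
      finally show "(\<integral>\<^sup>+x. h j (x j) \<partial>?A) = emeasure (bern p) (F j)" .
    qed
    finally show "emeasure (distr (?A \<Otimes>\<^sub>M ?B) ?P ?t) ?E = (\<Prod>j\<in>J. emeasure (bern p) (F j))" .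
  qed simp
qed

text \<open>Each \<open>Q j\<close> factors through the restriction to the block \<open>K j\<close>,
  and restrictions to disjoint blocks are independent. Blocks being finite, every set of restricted
  configurations is measurable.\<close>

lemma prob_indep_finite:
  fixes Q :: "'j \<Rightarrow> ('i \<Rightarrow> bool) \<Rightarrow> bool" and p :: real
  assumes I: "finite I" and J: "finite J" "\<And>j. j \<in> J \<Longrightarrow> K j \<subseteq> I" "disjoint_family_on K J"
    and Q: "\<And>j x y. j \<in> J \<Longrightarrow> (\<And>i. i \<in> K j \<Longrightarrow> x i = y i) \<Longrightarrow> Q j x = Q j y"
  defines "M \<equiv> PiM I (\<lambda>_. bern p)"
  shows "measure M {\<omega> \<in> space M. \<forall>j\<in>J. Q j \<omega>} = (\<Prod>j\<in>J. measure M {\<omega> \<in> space M. Q j \<omega>})"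
proof (cases "J = {}")
  case True
  interpret prob_space M unfolding M_def by (rule prob_space_bern_PiM)
  show ?thesis using True by (simp add: prob_space)
next
  case False
  interpret prob_space M unfolding M_def by (rule prob_space_bern_PiM)
  have ind: "indep_vars (\<lambda>j. PiM (K j) (\<lambda>_. bern p)) (\<lambda>j \<omega>. restrict (\<lambda>i. \<omega> i) (K j)) J"
    using indep_vars_restrict[OF indep_coordinates[of I p, folded M_def] J(2,3)] by simp
  define A where "A = (\<lambda>j. {x \<in> extensional (K j). Q j x})"
  have eq: "(\<lambda>\<omega>. restrict (\<lambda>i. \<omega> i) (K j)) -` A j \<inter> space M = {\<omega> \<in> space M. Q j \<omega>}" if "j \<in> J" for j
    using Q[OF that, of "restrict _ (K j)"] by (auto simp: A_def)
  have "prob (\<Inter>j\<in>J. (\<lambda>\<omega>. restrict (\<lambda>i. \<omega> i) (K j)) -` A j \<inter> space M)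
      = (\<Prod>j\<in>J. prob ((\<lambda>\<omega>. restrict (\<lambda>i. \<omega> i) (K j)) -` A j \<inter> space M))"
    using False J(1)
  proof (rule indep_varsD_finite[OF ind])
    fix j assume "j \<in> J"
    then have "finite (K j)" using J(2) I finite_subset by blast
    then show "A j \<in> sets (PiM (K j) (\<lambda>_. bern p))" by (auto simp: sets_bern_PiM_finite A_def)
  qed
  moreover have "(\<Inter>j\<in>J. (\<lambda>\<omega>. restrict (\<lambda>i. \<omega> i) (K j)) -` A j \<inter> space M)
      = {\<omega> \<in> space M. \<forall>j\<in>J. Q j \<omega>}" using False by (auto simp: eq)
  ultimately show ?thesis by (simp add: eq)
qed


subsection \<open>Percolation events\<close>

lemma verts_open_graph [simp]: "verts (open_graph G \<omega>) = verts G"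
  by (simp add: open_graph_def)

lemma edges_open_graph: "e \<in> edges (open_graph G \<omega>) \<longleftrightarrow> e \<in> edges G \<and> \<omega> e"
  by (simp add: open_graph_def)

lemma pred_edge_open [measurable]:
  "Measurable.pred (percolation G p) (\<lambda>\<omega>. e \<in> edges (open_graph G \<omega>))"
proof (cases "e \<in> edges G")
  case True
  have "(\<lambda>\<omega>. \<omega> e) \<in> percolation G p \<rightarrow>\<^sub>M bern p"
    unfolding percolation_def using True by (rule measurable_component_singleton)
  then show ?thesis using True by (simp add: edges_open_graph cong: measurable_cong_sets)
qed (simp add: edges_open_graph)

lemma pred_bex_countable:
  assumes "countable I" "\<And>i. i \<in> I \<Longrightarrow> Measurable.pred M (P i)"
  shows "Measurable.pred M (\<lambda>x. \<exists>i\<in>I. P i x)"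
  using sets.sets_Collect_countable_Ex'[of I M P] assms by (simp add: pred_def)

lemma pred_nball:
  assumes "countable (verts G)" "simple_graph G" "v \<in> verts G"
  shows "Measurable.pred (percolation G p) (\<lambda>\<omega>. w \<in> nball (open_graph G \<omega>) v j)"
proof (induction j arbitrary: w)
  case (Suc j)
  have "w \<in> nball (open_graph G \<omega>) v (Suc j) \<longleftrightarrow> w \<in> nball (open_graph G \<omega>) v j \<or>
      (\<exists>u\<in>verts G. u \<in> nball (open_graph G \<omega>) v j \<and> {u, w} \<in> edges (open_graph G \<omega>))" for \<omega>
    using nball_subset_verts[OF simple_open_graph[OF assms(2)], of v \<omega> j] assms(3) by auto
  moreover have "Measurable.pred (percolation G p) (\<lambda>\<omega>. w \<in> nball (open_graph G \<omega>) v j \<or>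
      (\<exists>u\<in>verts G. u \<in> nball (open_graph G \<omega>) v j \<and> {u, w} \<in> edges (open_graph G \<omega>)))"
    using Suc assms(1) by (intro pred_intros_logic pred_bex_countable pred_edge_open) auto
  ultimately show ?case by (simp only:)
qed simp

text \<open>Prepares measurability: a countable graph has only countably many finite vertex sets,
  and that such a set lies in the component is expressed by countably many ball events.\<close>

lemma large_comp_iff_subset:
  "large_comp k H v \<longleftrightarrow> (\<exists>S. finite S \<and> card S = k \<and> S \<subseteq> graph_component H v)"
  unfolding large_comp_def
  by (metis card_mono infinite_arbitrarily_large obtain_subset_with_card_n)

lemma pred_large_comp:
  assumes "countable (verts G)" "simple_graph G" "v \<in> verts G"
  shows "Measurable.pred (percolation G p) (\<lambda>\<omega>. large_comp k (open_graph G \<omega>) v)"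
proof -
  have "large_comp k (open_graph G \<omega>) v \<longleftrightarrow> (\<exists>S\<in>{S. finite S \<and> S \<subseteq> verts G}. card S = k \<and>
      (\<forall>w\<in>S. w \<in> verts G \<longrightarrow> (\<exists>j. w \<in> nball (open_graph G \<omega>) v j)))" for \<omega>
  proof -
    define C where "C = graph_component (open_graph G \<omega>) v"
    have "C \<subseteq> verts G" by (auto simp: C_def graph_component_def)
    then have "(\<exists>S. finite S \<and> card S = k \<and> S \<subseteq> C) \<longleftrightarrow>
        (\<exists>S\<in>{S. finite S \<and> S \<subseteq> verts G}. card S = k \<and> (\<forall>w\<in>S. w \<in> verts G \<longrightarrow> w \<in> C))"
      by blast
    moreover have "w \<in> C \<longleftrightarrow> (\<exists>j. w \<in> nball (open_graph G \<omega>) v j)" for w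
      unfolding C_def using assms(3)
      by (simp add: graph_component_eq_Union_nball simple_open_graph[OF assms(2)])
    ultimately show ?thesis by (simp add: large_comp_iff_subset C_def)
  qed
  moreover have "Measurable.pred (percolation G p) (\<lambda>\<omega>. \<exists>S\<in>{S. finite S \<and> S \<subseteq> verts G}. card S = k \<and>
      (\<forall>w\<in>S. w \<in> verts G \<longrightarrow> (\<exists>j. w \<in> nball (open_graph G \<omega>) v j)))"
  proof (rule pred_bex_countable)
    show "countable {S. finite S \<and> S \<subseteq> verts G}"
      using assms(1) by (rule countable_Collect_finite_subset)
    fix S assume "S \<in> {S. finite S \<and> S \<subseteq> verts G}"
    then show "Measurable.pred (percolation G p) (\<lambda>\<omega>. card S = k \<and>
        (\<forall>w\<in>S. w \<in> verts G \<longrightarrow> (\<exists>j. w \<in> nball (open_graph G \<omega>) v j)))"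
      by (intro pred_intros_logic pred_intros_finite pred_intros_countable pred_nball assms) auto
  qed
  ultimately show ?thesis by (simp only:)
qed

lemma pred_infinite_comp:
  assumes "countable (verts G)" "simple_graph G" "v \<in> verts G"
  shows "Measurable.pred (percolation G p) (\<lambda>\<omega>. infinite (graph_component (open_graph G \<omega>) v))"
  unfolding infinite_comp_iff_large
  using assms by (intro pred_intros_countable pred_large_comp)

section \<open>Probabilities of large and infinite components\<close>

definition large_prob :: "'v graph \<Rightarrow> real \<Rightarrow> nat \<Rightarrow> 'v \<Rightarrow> real" where
  "large_prob G p k v =
     measure (percolation G p) {\<omega> \<in> space (percolation G p). large_comp k (open_graph G \<omega>) v}"

lemma large_prob_bounds: "0 \<le> large_prob G p k v" "large_prob G p k v \<le> 1"
proof -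
  interpret prob_space "percolation G p" by (rule prob_space_percolation)
  show "0 \<le> large_prob G p k v" "large_prob G p k v \<le> 1" by (simp_all add: large_prob_def)
qed

text \<open>A configuration on \<open>G'\<close> is pulled back to the ball of \<open>G\<close> by
  giving each edge the state of its image under \<open>f\<close>. Distinct edges have distinct
  images, so the result has the product law, and the event is decided inside the ball of radius
  \<open>k\<close>.\<close>

lemma large_prob_induced_ball:
  fixes G :: "'v graph" and G' :: "'w graph"
  assumes G: "simple_graph G" "degrees_at_most G \<Delta>" "v \<in> verts G"
    and G': "simple_graph G'" "degrees_at_most G' \<Delta>" "v' \<in> verts G'"
    and iso: "ball_iso k G v G' v' f"
  shows "large_prob G' p k v' = large_prob (induced_subgraph G (nball G v k)) p k v"
proof -
  define B where "B = induced_subgraph G (nball G v k)"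
  have VB: "verts B = nball G v k" and EB: "edges B = {e \<in> edges G. e \<subseteq> nball G v k}"
    by (simp_all add: B_def induced_subgraph_def)
  have sB: "simple_graph B" using G(1) by (auto simp: simple_graph_def VB EB)
  have dB: "degrees_at_most B \<Delta>"
    using G(2) by (rule degrees_at_most_subgraph)
      (use nball_subset_verts[OF G(1,3), of k] VB EB in auto)
  have vB: "v \<in> verts B" by (simp add: VB)
  have finB: "finite (verts B)" using finite_nball[OF G(1,2)] VB by simp
  have bij: "bij_betw f (nball G v k) (nball G' v' k)" and fv: "f v = v'" 
    and edge: "\<And>x y. x \<in> nball G v k \<Longrightarrow> y \<in> nball G v k \<Longrightarrow> {x, y} \<in> edges G \<longleftrightarrow> {f x, f y} \<in> edges G'"
    using iso by (auto simp: ball_iso_def)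
  have inj: "inj_on f (nball G v k)" using bij by (simp add: bij_betw_def)
  have pair: "\<exists>x\<in>nball G v k. \<exists>y\<in>nball G v k. e = {x, y} \<and> {x, y} \<in> edges G" if "e \<in> edges B" for e
  proof -
    have "card e = 2" "e \<in> edges G" "e \<subseteq> nball G v k" using that G(1) by (auto simp: EB simple_graph_def)
    then show ?thesis by (auto simp: card_2_iff)
  qed
  have F_inj: "inj_on ((`) f) (edges B)"
    by (rule inj_on_subset[OF inj_on_image_Pow[OF inj]]) (auto simp: EB)
  have F_in: "(`) f \<in> edges B \<rightarrow> edges G'"
  proof
    fix e assume "e \<in> edges B"
    then obtain x y where "x \<in> nball G v k" "y \<in> nball G v k" "e = {x, y}" "{x, y} \<in> edges G"
      using pair by blast
    then show "f ` e \<in> edges G'" using edge by simp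
  qed
  define t where "t = (\<lambda>\<omega>::'w set \<Rightarrow> bool. \<lambda>e\<in>edges B. \<omega> (f ` e))"
  have distr: "distr (percolation G' p) (percolation B p) t = percolation B p"
    unfolding percolation_def t_def
    using distr_PiM_reindex[of "edges G'" "\<lambda>_. bern p" "(`) f" "edges B", OF prob_space_measure_pmf F_inj F_in] .
  have tm: "t \<in> percolation G' p \<rightarrow>\<^sub>M percolation B p"
    unfolding percolation_def t_def using F_in
    by (intro measurable_restrict measurable_component_singleton) auto
  have nb: "f ` nball (open_graph B (t \<omega>)) v k = nball (open_graph G' \<omega>) v' k" for \<omega>
  proof (rule ball_iso_image_nball[OF iso])
    show "edges (open_graph B (t \<omega>)) \<subseteq> edges G" "edges (open_graph G' \<omega>) \<subseteq> edges G'"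
      by (auto simp: edges_open_graph EB)
    fix x y assume xy: "x \<in> nball G v k" "y \<in> nball G v k"
    then show "{x, y} \<in> edges (open_graph B (t \<omega>)) \<longleftrightarrow> {f x, f y} \<in> edges (open_graph G' \<omega>)"
      using edge[OF xy] by (auto simp: edges_open_graph EB t_def)
  qed simp
  have large: "large_comp k (open_graph B (t \<omega>)) v \<longleftrightarrow> large_comp k (open_graph G' \<omega>) v'" for \<omega>
  proof -
    have "nball (open_graph B (t \<omega>)) v k \<subseteq> nball G v k"
      by (rule nball_subgraph) (auto simp: edges_open_graph EB)
    then have "card (nball (open_graph G' \<omega>) v' k) = card (nball (open_graph B (t \<omega>)) v k)"
      unfolding nb[symmetric] by (intro card_image inj_on_subset[OF inj])
    then show ?thesis
      using large_comp_iff_nball[OF simple_open_graph[OF sB] degrees_open_graph[OF dB], of v "t \<omega>" k]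
        large_comp_iff_nball[OF simple_open_graph[OF G'(1)] degrees_open_graph[OF G'(2)], of v' \<omega> k]
        vB G'(3) by simp
  qed
  let ?T = "{\<omega> \<in> space (percolation B p). large_comp k (open_graph B \<omega>) v}"
  have T: "?T \<in> sets (percolation B p)"
    using pred_large_comp[OF countable_finite[OF finB] sB vB] by (simp add: pred_def)
  have "large_prob B p k v = measure (distr (percolation G' p) (percolation B p) t) ?T"
    by (simp only: large_prob_def distr)
  also have "\<dots> = measure (percolation G' p) (t -` ?T \<inter> space (percolation G' p))"
    by (rule measure_distr[OF tm T])
  also have "t -` ?T \<inter> space (percolation G' p) =
      {\<omega> \<in> space (percolation G' p). large_comp k (open_graph G' \<omega>) v'}"
    using large measurable_space[OF tm] by auto
  finally show ?thesis by (simp add: large_prob_def B_def)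
qed

text \<open>Both values agree with the one on the induced ball; for \<open>G\<close> itself this is
  the case of the identity isomorphism.\<close>

lemma large_prob_ball_iso:
  assumes "simple_graph G" "degrees_at_most G \<Delta>" "v \<in> verts G"
    and "simple_graph G'" "degrees_at_most G' \<Delta>" "v' \<in> verts G'"
    and "ball_iso k G v G' v' f"
  shows "large_prob G p k v = large_prob G' p k v'"
proof -
  have "ball_iso k G v G v id" by (simp add: ball_iso_def)
  then show ?thesis
    using large_prob_induced_ball[OF assms] large_prob_induced_ball[OF assms(1-3) assms(1-3)] by metis
qed

definition infinite_prob :: "'v graph \<Rightarrow> real \<Rightarrow> 'v \<Rightarrow> real" where
  "infinite_prob G p v =
     measure (percolation G p) {\<omega> \<in> space (percolation G p). infinite (graph_component (open_graph G \<omega>) v)}"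

lemma large_prob_tendsto:
  assumes "countable (verts G)" "simple_graph G" "v \<in> verts G"
  shows "(\<lambda>k. large_prob G p k v) \<longlonglongrightarrow> infinite_prob G p v"
proof -
  interpret prob_space "percolation G p" by (rule prob_space_percolation)
  let ?A = "\<lambda>k. {\<omega> \<in> space (percolation G p). large_comp k (open_graph G \<omega>) v}"
  have "(\<lambda>k. prob (?A k)) \<longlonglongrightarrow> prob (\<Inter>k. ?A k)"
    using pred_large_comp[OF assms, where p = p]
    by (intro finite_Lim_measure_decseq) (auto simp: pred_def decseq_def intro: large_comp_antimono)
  moreover have "(\<Inter>k. ?A k) = {\<omega> \<in> space (percolation G p). infinite (graph_component (open_graph G \<omega>) v)}"
    by (auto simp: infinite_comp_iff_large)
  ultimately show ?thesis by (simp add: large_prob_def infinite_prob_def)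
qed

lemma infinite_prob_le:
  assumes "countable (verts G)" "simple_graph G" "v \<in> verts G"
  shows "infinite_prob G p v \<le> prob_infinite_component G p"
proof -
  interpret prob_space "percolation G p" by (rule prob_space_percolation)
  have "{\<omega> \<in> space (percolation G p). \<exists>C\<in>graph_components (open_graph G \<omega>). infinite C} =
      {\<omega> \<in> space (percolation G p). \<exists>v\<in>verts G. infinite (graph_component (open_graph G \<omega>) v)}"
    by (auto simp: graph_components_def)
  moreover have "Measurable.pred (percolation G p)
      (\<lambda>\<omega>. \<exists>v\<in>verts G. infinite (graph_component (open_graph G \<omega>) v))"
    using assms by (intro pred_bex_countable pred_infinite_comp)
  ultimately show ?thesis unfolding infinite_prob_def prob_infinite_component_def
    using assms by (intro finite_measure_mono) (auto simp: pred_def)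
qed

text \<open>Otherwise the existence of an infinite component would be a countable union of null
  events.\<close>

lemma ex_infinite_prob_pos:
  assumes "countable (verts G)" "simple_graph G" "0 < prob_infinite_component G p"
  shows "\<exists>v\<in>verts G. 0 < infinite_prob G p v"
proof (rule ccontr)
  assume *: "\<not> (\<exists>v\<in>verts G. 0 < infinite_prob G p v)"
  interpret prob_space "percolation G p" by (rule prob_space_percolation)
  let ?A = "\<lambda>v. {\<omega> \<in> space (percolation G p). infinite (graph_component (open_graph G \<omega>) v)}"
  have A: "?A v \<in> events" if "v \<in> verts G" for v
    using pred_infinite_comp[OF assms(1,2) that] by (simp add: pred_def)
  have "?A v \<in> null_sets (percolation G p)" if "v \<in> verts G" for v
    using * A[OF that] that by (auto simp: null_sets_def emeasure_eq_measure infinite_prob_def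
      not_less measure_le_0_iff)
  then have "(\<Union>v\<in>verts G. ?A v) \<in> null_sets (percolation G p)"
    using assms(1) by (intro null_sets_UN') auto
  moreover have "{\<omega> \<in> space (percolation G p). \<exists>C\<in>graph_components (open_graph G \<omega>). infinite C} =
      (\<Union>v\<in>verts G. ?A v)"
    by (auto simp: graph_components_def)
  ultimately show False using assms(3)
    by (simp add: prob_infinite_component_def null_sets_def emeasure_eq_measure)
qed


section \<open>Paths, unions of configurations, and percolation at a prescribed vertex\<close>

lemma adj_mono: "edges H \<subseteq> edges H' \<Longrightarrow> adj H \<subseteq> adj H'"
  by (auto simp: adj_def)

lemma rtrancl_adj_iff_nball: "(u, v) \<in> (adj G)\<^sup>* \<longleftrightarrow> (\<exists>i. v \<in> nball G u i)"
proof -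
  have "v \<in> (\<Union>i. nball G u i) \<longleftrightarrow> v \<in> {w. (u, w) \<in> (adj G)\<^sup>*}" by (simp only: Union_nball)
  then show ?thesis by simp
qed

text \<open>\<open>P\<close> collects the edges of a path. The vertex set \<open>V\<close> stays
  arbitrary so that the path can be read over \<open>verts G\<close> or, for \<open>joins\<close>,
  over the empty set.\<close>

lemma nball_path_edges:
  assumes "w \<in> nball H v i"
  shows "\<exists>P\<subseteq>edges H. finite P \<and> card P \<le> i \<and> w \<in> nball (V, P) v i"
  using assms
proof (induction i arbitrary: w)
  case (Suc i)
  show ?case
  proof (cases "w \<in> nball H v i")
    case True
    then obtain P where "P \<subseteq> edges H" "finite P" "card P \<le> i" "w \<in> nball (V, P) v i"
      using Suc.IH by blast
    then show ?thesis by (intro exI[of _ P]) auto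
  next
    case False
    then obtain u where u: "u \<in> nball H v i" "{u, w} \<in> edges H" using Suc.prems by auto
    then obtain P where P: "P \<subseteq> edges H" "finite P" "card P \<le> i" "u \<in> nball (V, P) v i"
      using Suc.IH by blast
    have "u \<in> nball (V, insert {u, w} P) v i"
      using P(4) nball_subgraph[of "(V, P)" "(V, insert {u, w} P)" v i] by auto
    then have "w \<in> nball (V, insert {u, w} P) v (Suc i)" by auto
    moreover have "card (insert {u, w} P) \<le> Suc i" using P(2,3) card_insert_le_m1
      by (simp add: card_insert_if)
    ultimately show ?thesis using P u by (intro exI[of _ "insert {u, w} P"]) simp
  qed
qed (auto intro!: exI[of _ "{}"])

lemma prob_all_open:
  assumes "0 \<le> b" "b \<le> 1" "finite P" "P \<subseteq> edges G"
  shows "measure (percolation G b) {y \<in> space (percolation G b). \<forall>e\<in>P. y e} = b ^ card P"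
    and "{y \<in> space (percolation G b). \<forall>e\<in>P. y e} \<in> sets (percolation G b)"
proof -
  interpret product_prob_space "\<lambda>_. bern b" "edges G" by unfold_locales
  have "emeasure (percolation G b) {y \<in> space (percolation G b). \<forall>e\<in>P. y e \<in> {True}} = (\<Prod>e\<in>P. emeasure (bern b) {True})"
    unfolding percolation_def using assms by (intro emeasure_PiM_Collect) auto
  also have "\<dots> = ennreal (b ^ card P)"
    using assms emeasure_bern[of b "{True}"] by (simp add: ennreal_power)
  finally show "measure (percolation G b) {y \<in> space (percolation G b). \<forall>e\<in>P. y e} = b ^ card P"
    using assms by (simp add: measure_def)
  have "Measurable.pred (percolation G b) (\<lambda>y. \<forall>e\<in>P. e \<in> edges (open_graph G y))"
    using assms(3) by (intro pred_intros_finite pred_edge_open)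
  also have "(\<lambda>y. \<forall>e\<in>P. e \<in> edges (open_graph G y)) = (\<lambda>y. \<forall>e\<in>P. y e)"
    using assms(4) by (auto simp: edges_open_graph fun_eq_iff)
  finally show "{y \<in> space (percolation G b). \<forall>e\<in>P. y e} \<in> sets (percolation G b)"
    by (simp add: pred_def)
qed

text \<open>Restricting to \<open>edges G\<close> keeps the result extensional, as points of the
  product space must be.\<close>

definition union_config :: "'v graph \<Rightarrow> ('v set \<Rightarrow> bool) \<times> ('v set \<Rightarrow> bool) \<Rightarrow> 'v set \<Rightarrow> bool" where
  "union_config G = (\<lambda>(x, y). \<lambda>e\<in>edges G. x e \<or> y e)"

lemma edges_union_config:
  "edges (open_graph G (union_config G (x, y))) = edges (open_graph G x) \<union> edges (open_graph G y)"
  by (auto simp: open_graph_def union_config_def)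

lemma distr_union_config:
  assumes "0 \<le> a" "a \<le> 1" "0 \<le> b" "b \<le> 1" "p = a + (1 - a) * b"
  shows "distr (percolation G a \<Otimes>\<^sub>M percolation G b) (percolation G p) (union_config G) = percolation G p"
  unfolding percolation_def union_config_def using assms by (rule bern_PiM_sprinkle)

lemma measurable_union_config:
  "union_config G \<in> percolation G a \<Otimes>\<^sub>M percolation G b \<rightarrow>\<^sub>M percolation G p"
  unfolding percolation_def union_config_def by (rule measurable_bern_union)

text \<open>Fix a finite path from \<open>u\<close> to \<open>v\<close>. The second configuration
  opens all of it with probability \<open>b ^ card P > 0\<close>, independently of the first one,
  and then the infinite component at \<open>v\<close> also contains \<open>u\<close>.\<close>

lemma infinite_prob_sprinkle:
  assumes G: "countable (verts G)" "simple_graph G" "connected_graph G" "u \<in> verts G" "v \<in> verts G"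
    and ab: "0 \<le> a" "a \<le> 1" "0 < b" "b \<le> 1"
    and pos: "0 < infinite_prob G a v"
  shows "0 < infinite_prob G (a + (1 - a) * b) u"
proof -
  define p where "p = a + (1 - a) * b"
  let ?A = "percolation G a" and ?B = "percolation G b" and ?P = "percolation G p"
  interpret A: prob_space ?A by (rule prob_space_percolation)
  interpret B: prob_space ?B by (rule prob_space_percolation)
  interpret AB: pair_prob_space ?A ?B ..
  have "(u, v) \<in> (adj G)\<^sup>*" using G by (simp add: connected_graph_def)
  then obtain i where i: "v \<in> nball G u i" unfolding rtrancl_adj_iff_nball by blast
  then obtain P where P: "P \<subseteq> edges G" "finite P" "v \<in> nball (verts G, P) u i"
    using nball_path_edges[OF i] by blast
  let ?I = "\<lambda>M v. {\<omega> \<in> space M. infinite (graph_component (open_graph G \<omega>) v)}"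
  define S1 where "S1 = ?I ?A v"
  define S2 where "S2 = {y \<in> space ?B. \<forall>e\<in>P. y e}"
  have S1: "S1 \<in> sets ?A" using pred_infinite_comp[OF G(1,2,5)] by (simp add: S1_def pred_def)
  have S2: "S2 \<in> sets ?B" "B.prob S2 = b ^ card P"
    unfolding S2_def using prob_all_open[of b P G] ab P by auto
  have T: "?I ?P u \<in> sets ?P" using pred_infinite_comp[OF G(1,2,4)] by (simp add: pred_def)
  have sub: "S1 \<times> S2 \<subseteq> union_config G -` ?I ?P u \<inter> space (?A \<Otimes>\<^sub>M ?B)"
  proof
    fix z assume "z \<in> S1 \<times> S2"
    then obtain x y where z: "z = (x, y)" "x \<in> S1" "y \<in> S2" by blast
    have zsp: "z \<in> space (?A \<Otimes>\<^sub>M ?B)" using z by (simp add: space_pair_measure S1_def S2_def)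
    let ?H = "open_graph G (union_config G z)"
    have sH: "simple_graph ?H" using G(2) by (rule simple_open_graph)
    have "P \<subseteq> edges ?H" using z P by (auto simp: edges_union_config S2_def edges_open_graph)
    then have "v \<in> nball ?H u i" using P(3) nball_subgraph[of "(verts G, P)" ?H u i] by auto
    then have uv: "(u, v) \<in> (adj ?H)\<^sup>*" unfolding rtrancl_adj_iff_nball by blast
    have "adj (open_graph G x) \<subseteq> adj ?H" by (rule adj_mono) (simp add: z edges_union_config)
    then have "graph_component (open_graph G x) v \<subseteq> graph_component ?H u"
      using uv rtrancl_mono[of "adj (open_graph G x)" "adj ?H"]
      unfolding graph_component_def by (auto intro: rtrancl_trans)
    then have "infinite (graph_component ?H u)" using z(2) finite_subset by (auto simp: S1_def)
    then show "z \<in> union_config G -` ?I ?P u \<inter> space (?A \<Otimes>\<^sub>M ?B)"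
      using zsp measurable_space[OF measurable_union_config zsp, of p] by simp
  qed
  have "0 < A.prob S1 * B.prob S2" using pos ab S2 by (simp add: S1_def infinite_prob_def)
  also have "\<dots> = measure (?A \<Otimes>\<^sub>M ?B) (S1 \<times> S2)"
    using S1 S2 by (simp add: measure_def B.emeasure_pair_measure_Times enn2real_mult)
  also have "\<dots> \<le> measure (?A \<Otimes>\<^sub>M ?B) (union_config G -` ?I ?P u \<inter> space (?A \<Otimes>\<^sub>M ?B))"
    using measurable_sets[OF measurable_union_config T] sub by (intro AB.finite_measure_mono)
  also have "\<dots> = measure (distr (?A \<Otimes>\<^sub>M ?B) ?P (union_config G)) (?I ?P u)"
    by (rule measure_distr[OF measurable_union_config T, symmetric])
  also have "\<dots> = infinite_prob G p u"
    using ab by (subst distr_union_config) (simp_all add: p_def infinite_prob_def)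
  finally show ?thesis by (simp add: p_def)
qed

text \<open>Keeps the set under the infimum in \<open>critical_prob\<close> nonempty. At parameter 1
  the countably many edges are almost surely all open, so the component of any vertex is the whole
  graph.\<close>

lemma prob_infinite_component_1:
  assumes G: "countable (verts G)" "simple_graph G" "connected_graph G" "infinite (verts G)"
  shows "0 < prob_infinite_component G 1"
proof -
  interpret prob_space "percolation G 1" by (rule prob_space_percolation)
  obtain v where v: "v \<in> verts G" using G(4) by (metis finite.emptyI equals0I)
  have "edges G \<subseteq> {S. finite S \<and> S \<subseteq> verts G}"
    using G(2) card.infinite by (fastforce simp: simple_graph_def)
  then have cE: "countable (edges G)"
    using countable_Collect_finite_subset[OF G(1)] countable_subset by blast
  have "AE \<omega> in percolation G 1. \<forall>e\<in>edges G. \<omega> e"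
    unfolding AE_ball_countable[OF cE]
  proof
    fix e assume "e \<in> edges G"
    have "y" if "y \<in> set_pmf (bernoulli_pmf 1)" for y
      using that by (cases y) (simp_all add: set_pmf_iff)
    then have "AE y in bern 1. y" unfolding AE_measure_pmf_iff by blast
    then show "AE \<omega> in percolation G 1. \<omega> e" unfolding percolation_def
      using AE_PiM_component[of "edges G" "\<lambda>_. bern 1" e "\<lambda>y. y"] prob_space_measure_pmf
        \<open>e \<in> edges G\<close> by blast
  qed
  then have "AE \<omega> in percolation G 1. infinite (graph_component (open_graph G \<omega>) v)"
  proof eventually_elim
    case (elim \<omega>)
    then have "open_graph G \<omega> = G" by (auto simp: open_graph_def prod_eq_iff)
    moreover have "graph_component G v = verts G"
      using G v by (auto simp: graph_component_def connected_graph_def)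
    ultimately show ?case using G by simp
  qed
  then have "infinite_prob G 1 v = 1" unfolding infinite_prob_def
    using pred_infinite_comp[OF G(1,2) v] by (subst prob_Collect_eq_1) (auto simp: pred_def)
  then show ?thesis using infinite_prob_le[OF G(1,2) v, of 1] by simp
qed

text \<open>The infimum supplies some \<open>a < p\<close> and a vertex \<open>u\<close> that
  percolates at \<open>a\<close>. One sprinkling raises the parameter to \<open>p\<close> and moves
  the infinite component to \<open>v\<close> at the same time.\<close>

lemma infinite_prob_supercritical:
  assumes G: "countable (verts G)" "simple_graph G" "connected_graph G" "infinite (verts G)" "v \<in> verts G"
    and p: "critical_prob G < p" "p \<le> 1"
  shows "0 < infinite_prob G p v"
proof -
  let ?S = "{p \<in> {0..1}. prob_infinite_component G p > 0}"
  have "?S \<noteq> {}" using prob_infinite_component_1[OF G(1-4)] by (auto intro!: exI[of _ 1])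
  then obtain a where a: "a \<in> ?S" "a < p"
    using p(1) unfolding critical_prob_def by (rule cInf_lessD[THEN bexE])
  then obtain u where u: "u \<in> verts G" "0 < infinite_prob G a u"
    using ex_infinite_prob_pos[OF G(1,2)] by blast
  \<comment> \<open>The solution of \<open>a + (1 - a) * b = p\<close>.\<close>
  define b where "b = (p - a) / (1 - a)"
  have "0 < b" "b \<le> 1" using a p by (auto simp: b_def)
  then have "0 < infinite_prob G (a + (1 - a) * b) v"
    using a u G by (intro infinite_prob_sprinkle[of G v u]) auto
  also have "a + (1 - a) * b = p" using a p by (simp add: b_def)
  finally show ?thesis .
qed

lemma infinite_prob_subcritical:
  assumes G: "countable (verts G)" "simple_graph G" "v \<in> verts G"
    and p: "p < critical_prob G" "0 \<le> p" "p \<le> 1"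
  shows "infinite_prob G p v = 0"
proof (rule antisym)
  have "prob_infinite_component G p \<le> 0"
  proof (rule ccontr)
    assume "\<not> prob_infinite_component G p \<le> 0"
    then have "critical_prob G \<le> p" unfolding critical_prob_def
      using p by (intro cInf_lower bdd_belowI[of _ 0]) auto
    then show False using p by simp
  qed
  then show "infinite_prob G p v \<le> 0" using infinite_prob_le[OF G, of p] by simp
qed (simp add: infinite_prob_def)


subsection \<open>Short connections in expanders\<close>

text \<open>\<open>P\<close> may be any edge set containing a path, which makes the notion monotone.
  Trivial paths count, so it is applied to disjoint \<open>A\<close> and \<open>B\<close>.\<close>

definition joins :: "'v set set \<Rightarrow> 'v set \<Rightarrow> 'v set \<Rightarrow> bool" where
  "joins P A B \<longleftrightarrow> (\<exists>a\<in>A. \<exists>b\<in>B. (a, b) \<in> (adj ({}, P))\<^sup>*)"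

lemma joins_mono: "joins P A B \<Longrightarrow> P \<subseteq> Q \<Longrightarrow> joins Q A B"
  using rtrancl_mono[OF adj_mono[of "({}, P)" "({}, Q)"]] unfolding joins_def by fastforce

lemma finite_edges: "finite_graph G \<Longrightarrow> finite (edges G)"
  by (rule finite_subset[of _ "Pow (verts G)"]) (auto simp: finite_graph_def simple_graph_def)

lemma card_edges_le:
  assumes "finite_graph G" "degrees_at_most G \<Delta>"
  shows "card (edges G) \<le> card (verts G) * \<Delta>"
proof -
  have fin: "finite (edges G)" "finite (verts G)"
    using assms(1) finite_edges[OF assms(1)] by (auto simp: finite_graph_def)
  have "edges G \<subseteq> (\<Union>v\<in>verts G. {e \<in> edges G. v \<in> e})"
  proof
    fix e assume e: "e \<in> edges G"
    then have "card e = 2" "e \<subseteq> verts G" using assms(1) by (auto simp: finite_graph_def simple_graph_def)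
    then obtain v where "v \<in> e" by (metis card.empty equals0I zero_neq_numeral)
    then show "e \<in> (\<Union>v\<in>verts G. {e \<in> edges G. v \<in> e})" using e \<open>e \<subseteq> verts G\<close> by blast
  qed
  then have "card (edges G) \<le> card (\<Union>v\<in>verts G. {e \<in> edges G. v \<in> e})"
    using fin by (intro card_mono) auto
  also have "\<dots> \<le> (\<Sum>v\<in>verts G. card {e \<in> edges G. v \<in> e})" using fin by (intro card_UN_le)
  also have "\<dots> \<le> (\<Sum>v\<in>verts G. \<Delta>)"
    using assms(2) by (intro sum_mono) (simp add: degrees_at_most_def)
  finally show ?thesis by simp
qed

lemma edges_between_commute: "edges_between G A B = edges_between G B A"
  unfolding edges_between_def by (auto simp: insert_commute)

text \<open>The Cheeger bound speaks about the smaller side of a cut; as the boundary is symmetric,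
  it can be applied to \<open>S\<close> or to its complement.\<close>

lemma cheeger_cut:
  assumes G: "finite_graph G" "ereal c \<le> cheeger G" "0 < c"
    and S: "S \<subseteq> verts G" "0 < m" "m \<le> real (card S)" "m \<le> real (card (verts G - S))"
  shows "c * m \<le> real (card (edges_between G S (verts G - S)))"
proof -
  have fin: "finite (verts G)" using G by (simp add: finite_graph_def)
  have small: "c * m \<le> real (card (edges_between G T (verts G - T)))"
    if T: "T \<subseteq> verts G" "m \<le> real (card T)" "real (card T) \<le> real (card (verts G)) / 2" for T
  proof -
    have pos: "0 < real (card T)" using T(2) S(2) by linarith
    have "cheeger G \<le> ereal (real (card (edges_between G T (verts G - T))) / real (card T))"
      unfolding cheeger_def using T pos by (intro INF_lower) simp
    then have "c \<le> real (card (edges_between G T (verts G - T))) / real (card T)"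
      using G(2) by (metis dual_order.trans ereal_less_eq(3))
    then have "c * real (card T) \<le> real (card (edges_between G T (verts G - T)))"
      using pos by (simp add: pos_le_divide_eq)
    moreover have "c * m \<le> c * real (card T)" using T(2) G(3) by simp
    ultimately show ?thesis by linarith
  qed
  show ?thesis
  proof (cases "real (card S) \<le> real (card (verts G)) / 2")
    case True
    then show ?thesis using small S by blast
  next
    case False
    have "card (verts G - S) = card (verts G) - card S" "card S \<le> card (verts G)"
      using fin S(1) by (auto intro: card_Diff_subset finite_subset card_mono)
    then have "real (card (verts G - S)) \<le> real (card (verts G)) / 2" using False by linarith
    then have "c * m \<le> real (card (edges_between G (verts G - S) (verts G - (verts G - S))))"
      using S by (intro small) auto
    moreover have "verts G - (verts G - S) = S" using S(1) by blast
    ultimately show ?thesis by (simp add: edges_between_commute)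
  qed
qed

text \<open>A maximal family of edge-disjoint connections of length at most \<open>L\<close> is large: after deleting
  its edges, the first \<open>L\<close> balls around \<open>A\<close> avoid \<open>B\<close>, so by expansion each of them would
  otherwise have a linear number of remaining boundary edges, and these edge sets are disjoint.\<close>

lemma many_disjoint_joins:
  assumes G: "finite_graph G" "degrees_at_most G \<Delta>" "ereal c \<le> cheeger G" "0 < c"
    and AB: "A \<subseteq> verts G" "B \<subseteq> verts G" "A \<inter> B = {}" "0 < \<alpha>"
      "\<alpha> * real (card (verts G)) \<le> real (card A)" "\<alpha> * real (card (verts G)) \<le> real (card B)"
    and L: "real \<Delta> < real L * (c * \<alpha> / 2)"
  obtains \<P> where "finite \<P>" "disjoint \<P>" "\<And>P. P \<in> \<P> \<Longrightarrow> P \<subseteq> edges G"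
    "\<And>P. P \<in> \<P> \<Longrightarrow> card P \<le> L" "\<And>P. P \<in> \<P> \<Longrightarrow> joins P A B"
    "c * \<alpha> * real (card (verts G)) / 2 \<le> real L * real (card \<P>)"
proof -
  define n where "n = card (verts G)"
  have fin: "finite (verts G)" "finite (edges G)" "simple_graph G" and n: "0 < n"
    using G(1) finite_edges[OF G(1)] by (auto simp: finite_graph_def n_def card_gt_0_iff)
  define \<F> where "\<F> = {\<P>. \<P> \<subseteq> Pow (edges G) \<and> disjoint \<P> \<and> (\<forall>P\<in>\<P>. card P \<le> L \<and> joins P A B)}"
  have "\<F> \<subseteq> Pow (Pow (edges G))" by (simp add: \<F>_def subset_iff)
  then have "finite \<F>" by (rule finite_subset) (simp add: fin(2))
  moreover have "{} \<in> \<F>" by (simp add: \<F>_def)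
  ultimately obtain \<P> where \<P>: "\<P> \<in> \<F>" and max: "\<And>\<Q>. \<Q> \<in> \<F> \<Longrightarrow> \<P> \<subseteq> \<Q> \<Longrightarrow> \<P> = \<Q>"
    using finite_has_maximal[of \<F>] by blast
  have sub: "\<P> \<subseteq> Pow (edges G)" and disj: "disjoint \<P>"
    and P: "\<And>P. P \<in> \<P> \<Longrightarrow> card P \<le> L" "\<And>P. P \<in> \<P> \<Longrightarrow> joins P A B"
    using \<P> by (auto simp: \<F>_def)
  have fin\<P>: "finite \<P>" using sub fin(2) finite_subset by blast
  define F where "F = \<Union>\<P>"
  have FE: "F \<subseteq> edges G" using sub unfolding F_def by blast
  then have finF: "finite F" using fin(2) by (rule finite_subset)
  have "card F \<le> (\<Sum>P\<in>\<P>. card P)" unfolding F_def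
    using card_Union_le_sum_card[of \<P>] by simp
  also have "\<dots> \<le> (\<Sum>P\<in>\<P>. L)" using P by (intro sum_mono)
  finally have cardF: "card F \<le> L * card \<P>" by (simp add: mult.commute)
  define H where "H = (verts G, edges G - F)"
  define S where "S i = (\<Union>a\<in>A. nball H a i)" for i
  have sH: "simple_graph H" using fin(3) by (auto simp: simple_graph_def H_def)
  have SV: "S i \<subseteq> verts G" for i
    unfolding S_def using nball_subset_verts[OF sH] AB(1) by (fastforce simp: H_def)
  have AS: "A \<subseteq> S i" for i unfolding S_def by auto
  have SB: "S i \<inter> B = {}" if "i \<le> L" for i
  proof (rule ccontr)
    assume "S i \<inter> B \<noteq> {}"
    then obtain a b where ab: "a \<in> A" "b \<in> B" "b \<in> nball H a i" unfolding S_def by blast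
    then obtain Q where Q: "Q \<subseteq> edges H" "finite Q" "card Q \<le> i" "b \<in> nball ({}, Q) a i"
      using nball_path_edges[OF ab(3), of "{}"] by blast
    have "(a, b) \<in> (adj ({}, Q))\<^sup>*" unfolding rtrancl_adj_iff_nball using Q(4) by blast
    then have jQ: "joins Q A B" unfolding joins_def using ab by blast
    have QF: "Q \<inter> F = {}" "Q \<subseteq> edges G" using Q(1) by (auto simp: H_def)
    have "disjoint (insert Q \<P>)"
      using disj QF(1) unfolding F_def disjoint_def by blast
    then have "insert Q \<P> \<in> \<F>"
      using \<P> QF Q(3) that jQ unfolding \<F>_def by auto
    \<comment> \<open>By maximality \<open>Q\<close> belongs to the family, hence lies in
      \<open>F\<close>. Being disjoint from \<open>F\<close> it is empty, so its path is trivial,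
      contradicting \<open>A \<inter> B = {}\<close>.\<close>
    then have "Q \<in> \<P>" using max[of "insert Q \<P>"] by blast
    then have "Q = {}" using QF(1) unfolding F_def by blast
    then have "a = b" using \<open>(a, b) \<in> (adj ({}, Q))\<^sup>*\<close> by (simp add: adj_def)
    then show False using ab AB(3) by blast
  qed
  define D where "D i = edges_between H (S i) (verts G - S i)" for i
  have DE: "D i \<subseteq> edges G" for i by (auto simp: D_def edges_between_def H_def)
  have D_ge: "c * \<alpha> * real n - real (card F) \<le> real (card (D i))" if "i \<le> L" for i
  proof -
    have "B \<subseteq> verts G - S i" using SB[OF that] AB(2) by blast
    then have "card B \<le> card (verts G - S i)" using fin by (intro card_mono) auto
    moreover have "card A \<le> card (S i)" using fin SV AS by (intro card_mono finite_subset[OF SV]) auto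
    ultimately have "c * (\<alpha> * real n) \<le> real (card (edges_between G (S i) (verts G - S i)))"
      using AB n by (intro cheeger_cut[OF G(1,3,4) SV]) (auto simp: n_def)
    also have "edges_between G (S i) (verts G - S i) \<subseteq> D i \<union> F"
      by (auto simp: D_def edges_between_def H_def)
    then have "card (edges_between G (S i) (verts G - S i)) \<le> card (D i \<union> F)"
      using finF finite_subset[OF DE fin(2)] by (intro card_mono) auto
    then have "real (card (edges_between G (S i) (verts G - S i))) \<le> real (card (D i)) + real (card F)"
      using card_Un_le[of "D i" F] by linarith
    finally show ?thesis by (simp add: mult.assoc)
  qed
  \<comment> \<open>An edge of \<open>H\<close> leaving \<open>S i\<close> has both ends in
    \<open>S (Suc i)\<close> and so leaves no later set.\<close>
  have D_disj: "D i \<inter> D j = {}" if "i < j" for i j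
  proof (rule ccontr)
    assume "D i \<inter> D j \<noteq> {}"
    then obtain e where e: "e \<in> D i" "e \<in> D j" by blast
    obtain x y where xy: "x \<in> S i" "e = {x, y}" "e \<in> edges H"
      using e(1) unfolding D_def edges_between_def by blast
    obtain a where a: "a \<in> A" "x \<in> nball H a i" using xy(1) unfolding S_def by blast
    have "x \<in> nball H a (Suc i)" "y \<in> nball H a (Suc i)" using a xy by auto
    then have "{x, y} \<subseteq> S j"
      using a(1) nball_mono[of "Suc i" j H a] that unfolding S_def by (auto simp del: nball.simps)
    then show False using e(2) xy(2) unfolding D_def edges_between_def by blast
  qed
  \<comment> \<open>The \<open>L\<close> disjoint boundaries fit into at most
    \<open>n * \<Delta>\<close> edges. The hypothesis on \<open>L\<close> makes this impossible
    unless more than \<open>c * \<alpha> * n / 2\<close> edges were deleted.\<close>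
  have "real L * (c * \<alpha> * real n - real (card F)) = (\<Sum>i<L. c * \<alpha> * real n - real (card F))" by simp
  also have "\<dots> \<le> (\<Sum>i<L. real (card (D i)))" by (intro sum_mono D_ge) simp
  also have "\<dots> = real (card (\<Union>i<L. D i))"
    using D_disj finite_subset[OF DE fin(2)]
    by (subst card_UN_disjoint) (auto, metis disjoint_iff nat_neq_iff)
  also have "\<dots> \<le> real (card (edges G))" using DE fin(2) by (intro of_nat_mono card_mono) auto
  also have "\<dots> \<le> real n * real \<Delta>"
    using card_edges_le[OF G(1,2)] unfolding n_def by (metis of_nat_le_iff of_nat_mult)
  also have "\<dots> < real n * (real L * (c * \<alpha> / 2))" using L n by simp
  finally have "real L * (c * \<alpha> * real n / 2) < real L * real (card F)" by (simp add: algebra_simps)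
  then have "c * \<alpha> * real n / 2 < real (card F)"
    by (rule mult_left_less_imp_less) simp
  also have "\<dots> \<le> real L * real (card \<P>)" using cardF by (metis of_nat_le_iff of_nat_mult)
  finally show thesis using that[of \<P>] fin\<P> disj sub P by (auto simp: n_def)
qed

text \<open>Adding elements one at a time, the sum is still below \<open>t\<close> just before it
  reaches \<open>t\<close>, and the next weight adds less than \<open>t\<close>.\<close>

lemma subset_sum_between:
  fixes w :: "'i \<Rightarrow> real"
  assumes "finite I" "0 < t" "\<And>i. i \<in> I \<Longrightarrow> w i < t" "t \<le> sum w I"
  shows "\<exists>J\<subseteq>I. t \<le> sum w J \<and> sum w J < 2 * t"
  using assms
proof (induction I)
  case (insert x I)
  show ?case
  proof (cases "t \<le> sum w I")
    case True
    then show ?thesis using insert.IH insert.prems by (meson insertI2 subset_insertI2)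
  next
    case False
    then have "sum w (insert x I) < 2 * t"
      using insert.prems(2)[of x] insert.hyps by simp
    then show ?thesis using insert.prems by blast
  qed
qed simp


subsection \<open>Sprinkling on a finite expander\<close>

definition giant :: "real \<Rightarrow> 'v graph \<Rightarrow> ('v set \<Rightarrow> bool) \<Rightarrow> bool" where
  "giant \<alpha> G \<omega> \<longleftrightarrow> (\<exists>C\<in>graph_components (open_graph G \<omega>). \<alpha> * real (card (verts G)) \<le> real (card C))"

definition large_set :: "nat \<Rightarrow> 'v graph \<Rightarrow> ('v set \<Rightarrow> bool) \<Rightarrow> 'v set" where
  "large_set k G \<omega> = {v \<in> verts G. large_comp k (open_graph G \<omega>) v}"

lemma graph_component_self: "v \<in> verts H \<Longrightarrow> v \<in> graph_component H v"
  by (simp add: graph_component_def)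

lemma graph_component_eq:
  assumes "w \<in> graph_component H v" shows "graph_component H w = graph_component H v"
proof -
  have "(v, w) \<in> (adj H)\<^sup>*" using assms by (simp add: graph_component_def)
  then have "(w, x) \<in> (adj H)\<^sup>* \<longleftrightarrow> (v, x) \<in> (adj H)\<^sup>*" for x
    using adj_rtrancl_sym[of v w H] by (meson rtrancl_trans)
  then show ?thesis by (simp add: graph_component_def)
qed

lemma graph_component_subset: "graph_component H v \<subseteq> verts H"
  by (auto simp: graph_component_def)

lemma graph_components_disjoint: "disjoint (graph_components H)"
  unfolding disjoint_def
proof (intro ballI impI)
  fix C D assume CD: "C \<in> graph_components H" "D \<in> graph_components H" "C \<noteq> D"
  show "C \<inter> D = {}"
  proof (rule ccontr)
    assume "C \<inter> D \<noteq> {}"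
    then obtain w where "w \<in> C" "w \<in> D" by blast
    then show False using CD graph_component_eq[of w H] unfolding graph_components_def by blast
  qed
qed

lemma large_set_closed:
  assumes "v \<in> large_set k G \<omega>" shows "graph_component (open_graph G \<omega>) v \<subseteq> large_set k G \<omega>"
proof
  fix w assume w: "w \<in> graph_component (open_graph G \<omega>) v"
  then show "w \<in> large_set k G \<omega>"
    using assms graph_component_eq[OF w] graph_component_subset[of "open_graph G \<omega>" v]
    by (auto simp: large_set_def large_comp_def)
qed

lemma card_large_components:
  assumes "finite (verts G)"
  shows "card (graph_component (open_graph G \<omega>) ` large_set k G \<omega>) * k \<le> card (verts G)"
proof -
  let ?C = "graph_component (open_graph G \<omega>) ` large_set k G \<omega>"
  have finC: "finite C" "k \<le> card C" "C \<subseteq> verts G" if "C \<in> ?C" for C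
  proof -
    obtain v where v: "C = graph_component (open_graph G \<omega>) v" "large_comp k (open_graph G \<omega>) v"
      using \<open>C \<in> ?C\<close> by (auto simp: large_set_def)
    show "C \<subseteq> verts G" using v graph_component_subset[of "open_graph G \<omega>" v] by simp
    then show "finite C" using assms finite_subset by blast
    then show "k \<le> card C" using v by (simp add: large_comp_def)
  qed
  have "?C \<subseteq> graph_components (open_graph G \<omega>)"
    by (auto simp: graph_components_def large_set_def)
  then have "disjoint ?C" by (rule pairwise_subset[OF graph_components_disjoint])
  then have "card (\<Union>?C) = (\<Sum>C\<in>?C. card C)"
    using finC(1) by (rule card_Union_disjoint)
  moreover have "(\<Sum>C\<in>?C. k) \<le> (\<Sum>C\<in>?C. card C)" using finC by (intro sum_mono)
  moreover have "card (\<Union>?C) \<le> card (verts G)" using finC assms by (intro card_mono) blast+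
  ultimately show ?thesis by simp
qed

text \<open>Each component of the union meets the large set in fewer than
  \<open>\<alpha> * n\<close> vertices. Grouping components until the weight lies between
  \<open>\<alpha> * n\<close> and \<open>2 * \<alpha> * n\<close> leaves at least
  \<open>\<alpha> * n\<close> for the other side: hence the factor 3. The split is described by
  components of \<open>x\<close>, so the list of candidates does not involve
  \<open>y\<close>.\<close>

lemma no_giant_split:
  assumes G: "finite_graph G" and "0 < \<alpha>"
    and large: "3 * (\<alpha> * real (card (verts G))) \<le> real (card (large_set k G x))"
    and no: "\<not> giant \<alpha> G (union_config G (x, y))"
  shows "\<exists>\<D>\<subseteq>graph_component (open_graph G x) ` large_set k G x.
    \<alpha> * real (card (verts G)) \<le> real (card (\<Union>\<D>)) \<and>
    \<alpha> * real (card (verts G)) \<le> real (card (large_set k G x - \<Union>\<D>)) \<and>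
    \<not> joins {e \<in> edges G. y e} (\<Union>\<D>) (large_set k G x - \<Union>\<D>)"
proof -
  define W where "W = large_set k G x"
  define t where "t = \<alpha> * real (card (verts G))"
  define Hx where "Hx = open_graph G x"
  define H where "H = open_graph G (union_config G (x, y))"
  have fin: "finite (verts G)" "verts G \<noteq> {}" using G by (auto simp: finite_graph_def)
  have t: "0 < t" using fin \<open>0 < \<alpha>\<close> by (simp add: t_def card_gt_0_iff)
  have VH: "verts H = verts G" "verts Hx = verts G" by (simp_all add: H_def Hx_def)
  have EH: "edges H = edges (open_graph G x) \<union> edges (open_graph G y)"
    by (simp add: H_def edges_union_config)
  have WV: "W \<subseteq> verts G" by (auto simp: W_def large_set_def)
  have finW: "finite W" using WV fin finite_subset by blast
  let ?I = "graph_components H"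
  have finI: "finite ?I" unfolding graph_components_def using fin VH by simp
  have CV: "C \<subseteq> verts G" if "C \<in> ?I" for C
    using that graph_component_subset[of H] VH by (auto simp: graph_components_def)
  have finC: "finite C" if "C \<in> ?I" for C using CV[OF that] fin finite_subset by blast
  define w where "w C = real (card (C \<inter> W))" for C
  have sum_w: "sum w J = real (card (\<Union>C\<in>J. C \<inter> W))" if "J \<subseteq> ?I" for J
  proof -
    have "card (\<Union>C\<in>J. C \<inter> W) = (\<Sum>C\<in>J. card (C \<inter> W))"
    proof (rule card_UN_disjoint)
      show "finite J" using that finI finite_subset by blast
      show "\<forall>i\<in>J. finite (i \<inter> W)" using finW by blast
      show "\<forall>i\<in>J. \<forall>j\<in>J. i \<noteq> j \<longrightarrow> i \<inter> W \<inter> (j \<inter> W) = {}"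
        using graph_components_disjoint[of H] that unfolding disjoint_def by blast
    qed
    then show ?thesis by (simp add: w_def)
  qed
  have "(\<Union>C\<in>?I. C \<inter> W) = W"
    using WV graph_component_self[of _ H] VH unfolding graph_components_def by blast
  then have "sum w ?I = real (card W)" using sum_w[of ?I] by simp
  then have ge: "t \<le> sum w ?I" using large t by (simp add: W_def t_def)
  have lt: "w C < t" if "C \<in> ?I" for C
  proof -
    have "real (card C) < t" using no that unfolding giant_def H_def t_def by force
    moreover have "card (C \<inter> W) \<le> card C" using finC[OF that] by (intro card_mono) auto
    ultimately show ?thesis by (simp add: w_def)
  qed
  obtain J where J: "J \<subseteq> ?I" "t \<le> sum w J" "sum w J < 2 * t"
    using subset_sum_between[OF finI t lt ge] by blast
  define A where "A = (\<Union>C\<in>J. C \<inter> W)"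
  define \<D> where "\<D> = graph_component Hx ` A"
  have AW: "A \<subseteq> W" by (auto simp: A_def)
  \<comment> \<open>Every component of \<open>x\<close> lies within one component of the union, so
    grouping the latter never cuts the former.\<close>
  have "\<Union>\<D> = A"
  proof
    show "A \<subseteq> \<Union>\<D>" unfolding \<D>_def using AW WV graph_component_self[of _ Hx] VH by blast
    show "\<Union>\<D> \<subseteq> A"
    proof
      fix b assume "b \<in> \<Union>\<D>"
      then obtain a where a: "a \<in> A" "b \<in> graph_component Hx a" unfolding \<D>_def by blast
      then obtain C where C: "C \<in> J" "a \<in> C" unfolding A_def by blast
      have "b \<in> W" using large_set_closed[of a k G x] a AW unfolding W_def Hx_def by blast
      have "(adj Hx)\<^sup>* \<subseteq> (adj H)\<^sup>*" by (intro rtrancl_mono adj_mono) (auto simp: EH Hx_def)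
      then have "b \<in> graph_component H a" using a(2) VH by (auto simp: graph_component_def)
      moreover have "graph_component H a = C"
        using C J(1) graph_component_eq[of a H] unfolding graph_components_def by blast
      ultimately show "b \<in> A" using C \<open>b \<in> W\<close> unfolding A_def by blast
    qed
  qed
  have cardA: "t \<le> real (card A)" "real (card A) < 2 * t" using J sum_w[OF J(1)] by (simp_all add: A_def)
  have "card (W - A) = card W - card A" "card A \<le> card W"
    using finW AW by (auto intro: card_Diff_subset finite_subset card_mono)
  then have cardWA: "t \<le> real (card (W - A))"
    using cardA large unfolding W_def[symmetric] t_def[symmetric] by linarith
  have "\<not> joins {e \<in> edges G. y e} A (W - A)"
  proof
    assume "joins {e \<in> edges G. y e} A (W - A)"
    then obtain a b where ab: "a \<in> A" "b \<in> W - A" "(a, b) \<in> (adj ({}, {e \<in> edges G. y e}))\<^sup>*"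
      unfolding joins_def by blast
    have "(adj ({}, {e \<in> edges G. y e}))\<^sup>* \<subseteq> (adj H)\<^sup>*"
      by (intro rtrancl_mono adj_mono) (auto simp: EH edges_open_graph)
    then have b: "b \<in> graph_component H a" using ab WV VH by (auto simp: graph_component_def)
    obtain C where C: "C \<in> J" "a \<in> C" using ab(1) unfolding A_def by blast
    have "graph_component H a = C"
      using C J(1) graph_component_eq[of a H] unfolding graph_components_def by blast
    then show False using C b ab(2) unfolding A_def by blast
  qed
  moreover have "\<D> \<subseteq> graph_component Hx ` W" unfolding \<D>_def using AW by blast
  ultimately show ?thesis using \<open>\<Union>\<D> = A\<close> cardA(1) cardWA
    unfolding W_def[symmetric] t_def[symmetric] Hx_def[symmetric] by blast
qed

text \<open>Settles all measurability questions on the finite graphs.\<close>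

lemma sets_percolation_finite:
  "finite (edges G) \<Longrightarrow> sets (percolation G p) = Pow (space (percolation G p))"
  unfolding space_percolation by (simp add: percolation_def sets_bern_PiM_finite)

text \<open>Edge-disjoint connections are open independently, each with probability at least
  \<open>q ^ L\<close>, so all of them fail with probability at most
  \<open>(1 - q ^ L) ^ card \<P>\<close>; then \<open>1 - x \<le> exp (- x)\<close> and the lower
  bound on their number apply.\<close>

lemma prob_no_joins:
  assumes G: "finite_graph G" "degrees_at_most G \<Delta>" "ereal c \<le> cheeger G" "0 < c"
    and AB: "A \<subseteq> verts G" "B \<subseteq> verts G" "A \<inter> B = {}" "0 < \<alpha>"
      "\<alpha> * real (card (verts G)) \<le> real (card A)" "\<alpha> * real (card (verts G)) \<le> real (card B)"
    and L: "real \<Delta> < real L * (c * \<alpha> / 2)" and q: "0 \<le> q" "q \<le> 1"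
  shows "measure (percolation G q) {y \<in> space (percolation G q). \<not> joins {e \<in> edges G. y e} A B}
    \<le> exp (- (q ^ L * (c * \<alpha> / (2 * real L)) * real (card (verts G))))"
proof -
  let ?M = "percolation G q"
  interpret prob_space ?M by (rule prob_space_percolation)
  have finE: "finite (edges G)" using G(1) by (rule finite_edges)
  have Lpos: "0 < L" using L by (cases L) auto
  obtain \<P> where \<P>: "finite \<P>" "disjoint \<P>" "\<And>P. P \<in> \<P> \<Longrightarrow> P \<subseteq> edges G"
    "\<And>P. P \<in> \<P> \<Longrightarrow> card P \<le> L" "\<And>P. P \<in> \<P> \<Longrightarrow> joins P A B"
    "c * \<alpha> * real (card (verts G)) / 2 \<le> real L * real (card \<P>)"
    using many_disjoint_joins[OF G AB L] by blast
  have ev: "{y \<in> space ?M. Q y} \<in> events" for Q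
    using sets_percolation_finite[OF finE] by blast
  have "prob {y \<in> space ?M. \<not> joins {e \<in> edges G. y e} A B}
      \<le> prob {y \<in> space ?M. \<forall>P\<in>\<P>. \<not> (\<forall>e\<in>P. y e)}"
  proof (rule finite_measure_mono[OF _ ev])
    show "{y \<in> space ?M. \<not> joins {e \<in> edges G. y e} A B} \<subseteq> {y \<in> space ?M. \<forall>P\<in>\<P>. \<not> (\<forall>e\<in>P. y e)}"
    proof
      fix y assume y: "y \<in> {y \<in> space ?M. \<not> joins {e \<in> edges G. y e} A B}"
      have "\<not> (\<forall>e\<in>P. y e)" if "P \<in> \<P>" for P
      proof
        assume "\<forall>e\<in>P. y e"
        then have "P \<subseteq> {e \<in> edges G. y e}" using \<P>(3)[OF that] by blast
        then show False using joins_mono[OF \<P>(5)[OF that]] y by blast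
      qed
      then show "y \<in> {y \<in> space ?M. \<forall>P\<in>\<P>. \<not> (\<forall>e\<in>P. y e)}" using y by blast
    qed
  qed
  also have "\<dots> = (\<Prod>P\<in>\<P>. prob {y \<in> space ?M. \<not> (\<forall>e\<in>P. y e)})"
    unfolding percolation_def
  proof (rule prob_indep_finite[OF finE \<P>(1), where K = "\<lambda>P. P"])
    show "disjoint_family_on (\<lambda>P. P) \<P>"
      using \<P>(2) by (auto simp: disjoint_def disjoint_family_on_def)
  qed (use \<P>(3) in auto)
  also have "\<dots> \<le> (\<Prod>P\<in>\<P>. exp (- (q ^ L)))"
  proof (intro prod_mono conjI)
    fix P assume P: "P \<in> \<P>"
    have "prob {y \<in> space ?M. \<not> (\<forall>e\<in>P. y e)} = 1 - prob {y \<in> space ?M. \<forall>e\<in>P. y e}"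
      by (rule prob_neg[OF ev])
    also have "\<dots> = 1 - q ^ card P"
      using prob_all_open(1)[OF q _ \<P>(3)[OF P]] finite_subset[OF \<P>(3)[OF P] finE] by simp
    also have "\<dots> \<le> 1 - q ^ L"
      using q \<P>(4)[OF P] by (simp add: power_decreasing)
    also have "\<dots> \<le> exp (- (q ^ L))" using exp_ge_add_one_self[of "- (q ^ L)"] by simp
    finally show "prob {y \<in> space ?M. \<not> (\<forall>e\<in>P. y e)} \<le> exp (- (q ^ L))" .
  qed simp
  also have "\<dots> = exp (- (q ^ L * real (card \<P>)))"
    by (simp add: exp_of_nat_mult[symmetric] mult.commute)
  also have "\<dots> \<le> exp (- (q ^ L * (c * \<alpha> / (2 * real L)) * real (card (verts G))))"
  proof -
    have "c * \<alpha> / (2 * real L) * real (card (verts G)) \<le> real (card \<P>)"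
      using \<P>(6) Lpos by (simp add: field_simps)
    then have "q ^ L * (c * \<alpha> / (2 * real L) * real (card (verts G))) \<le> q ^ L * real (card \<P>)"
      using q by (intro mult_left_mono) simp_all
    then show ?thesis by (simp add: mult.assoc)
  qed
  finally show ?thesis .
qed

text \<open>Union bound over the splits for a fixed \<open>x\<close>: there are at most
  \<open>2 ^ card \<C>\<close> of them, and \<open>card \<C> \<le> n / k\<close>, while each one
  survives with the probability bounded in \<open>prob_no_joins\<close>.\<close>

lemma prob_no_giant_sprinkled:
  assumes G: "finite_graph G" "degrees_at_most G \<Delta>" "ereal c \<le> cheeger G" "0 < c"
    and \<alpha>: "0 < \<alpha>" and L: "real \<Delta> < real L * (c * \<alpha> / 2)" and q: "0 \<le> q" "q \<le> 1" and k: "0 < k"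
    and large: "3 * (\<alpha> * real (card (verts G))) \<le> real (card (large_set k G x))"
  shows "measure (percolation G q) {y \<in> space (percolation G q). \<not> giant \<alpha> G (union_config G (x, y))}
    \<le> exp (real (card (verts G)) * (1 / real k - q ^ L * (c * \<alpha> / (2 * real L))))"
proof -
  let ?M = "percolation G q" and ?n = "real (card (verts G))" and ?W = "large_set k G x"
  interpret prob_space ?M by (rule prob_space_percolation)
  have finE: "finite (edges G)" using G(1) by (rule finite_edges)
  have fin: "finite (verts G)" using G(1) by (simp add: finite_graph_def)
  have WV: "?W \<subseteq> verts G" by (auto simp: large_set_def)
  have ev: "{y \<in> space ?M. Q y} \<in> events" for Q
    using sets_percolation_finite[OF finE] by blast
  define \<C> where "\<C> = graph_component (open_graph G x) ` ?W"
  have fin\<C>: "finite \<C>" unfolding \<C>_def using WV fin finite_subset by blast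
  define \<S> where "\<S> = {\<D>. \<D> \<subseteq> \<C> \<and> \<alpha> * ?n \<le> real (card (\<Union>\<D>)) \<and> \<alpha> * ?n \<le> real (card (?W - \<Union>\<D>))}"
  have \<S>: "finite \<S>" "card \<S> \<le> 2 ^ card \<C>"
  proof -
    have "\<S> \<subseteq> Pow \<C>" by (auto simp: \<S>_def)
    then show "finite \<S>" "card \<S> \<le> 2 ^ card \<C>"
      using fin\<C> finite_subset[of \<S> "Pow \<C>"] card_mono[of "Pow \<C>" \<S>] by (auto simp: card_Pow)
  qed
  define \<epsilon> where "\<epsilon> = exp (- (q ^ L * (c * \<alpha> / (2 * real L)) * ?n))"
  let ?N = "\<lambda>\<D>. {y \<in> space ?M. \<not> joins {e \<in> edges G. y e} (\<Union>\<D>) (?W - \<Union>\<D>)}"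
  have "prob {y \<in> space ?M. \<not> giant \<alpha> G (union_config G (x, y))} \<le> prob (\<Union>\<D>\<in>\<S>. ?N \<D>)"
  proof (rule finite_measure_mono)
    show "{y \<in> space ?M. \<not> giant \<alpha> G (union_config G (x, y))} \<subseteq> (\<Union>\<D>\<in>\<S>. ?N \<D>)"
    proof
      fix y assume y: "y \<in> {y \<in> space ?M. \<not> giant \<alpha> G (union_config G (x, y))}"
      then obtain \<D> where "\<D> \<in> \<S>" "\<not> joins {e \<in> edges G. y e} (\<Union>\<D>) (?W - \<Union>\<D>)"
        using no_giant_split[OF G(1) \<alpha> large, of y] unfolding \<S>_def \<C>_def by blast
      then show "y \<in> (\<Union>\<D>\<in>\<S>. ?N \<D>)" using y by blast
    qed
    show "(\<Union>\<D>\<in>\<S>. ?N \<D>) \<in> events" using \<S>(1) ev by (intro sets.finite_UN)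
  qed
  also have "\<dots> \<le> (\<Sum>\<D>\<in>\<S>. prob (?N \<D>))"
    using \<S>(1) ev by (intro measure_UNION_le)
  also have "\<dots> \<le> (\<Sum>\<D>\<in>\<S>. \<epsilon>)"
  proof (intro sum_mono)
    fix \<D> assume \<D>: "\<D> \<in> \<S>"
    have "\<Union>\<D> \<subseteq> verts G"
      using \<D> graph_component_subset[of "open_graph G x"] unfolding \<S>_def \<C>_def by fastforce
    then show "prob (?N \<D>) \<le> \<epsilon>" unfolding \<epsilon>_def
      using \<D> WV by (intro prob_no_joins[OF G _ _ _ \<alpha> _ _ L q]) (auto simp: \<S>_def)
  qed
  also have "\<dots> = real (card \<S>) * \<epsilon>" by simp
  also have "\<dots> \<le> exp (?n / real k) * \<epsilon>"
  proof (rule mult_right_mono)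
    have "real (card \<S>) \<le> 2 ^ card \<C>" using \<S>(2) by (metis of_nat_le_iff of_nat_numeral of_nat_power)
    \<comment> \<open>Replacing the base 2 by \<open>exp 1\<close> merges both factors into a single
      exponential.\<close>
    also have "\<dots> \<le> exp 1 ^ card \<C>" using exp_ge_add_one_self[of 1] by (intro power_mono) auto
    also have "\<dots> = exp (real (card \<C>))" by (simp add: exp_of_nat_mult[symmetric])
    also have "real (card \<C>) \<le> ?n / real k"
      using card_large_components[OF fin, of x k] k unfolding \<C>_def[symmetric]
      by (simp add: field_simps) (metis of_nat_le_iff of_nat_mult)
    finally show "real (card \<S>) \<le> exp (?n / real k)" by simp
  qed (simp add: \<epsilon>_def)
  also have "\<dots> = exp (?n * (1 / real k - q ^ L * (c * \<alpha> / (2 * real L))))"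
    unfolding \<epsilon>_def exp_add[symmetric] by (simp add: algebra_simps)
  finally show ?thesis .
qed

text \<open>Fubini over the first configuration: an \<open>x\<close> with too few vertices in large
  components is charged probability 1, any other \<open>x\<close> the bound of
  \<open>prob_no_giant_sprinkled\<close>.\<close>

lemma prob_no_giant:
  assumes G: "finite_graph G" "degrees_at_most G \<Delta>" "ereal c \<le> cheeger G" "0 < c"
    and \<alpha>: "0 < \<alpha>" and L: "real \<Delta> < real L * (c * \<alpha> / 2)" and k: "0 < k"
    and ab: "0 \<le> a" "a \<le> 1" "0 \<le> b" "b \<le> 1" "p = a + (1 - a) * b"
  shows "1 - prob_giant_component G p \<alpha> \<le>
    measure (percolation G a) {x \<in> space (percolation G a).
        real (card (large_set k G x)) < 3 * (\<alpha> * real (card (verts G)))} +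
    exp (real (card (verts G)) * (1 / real k - b ^ L * (c * \<alpha> / (2 * real L))))"
proof -
  let ?A = "percolation G a" and ?B = "percolation G b" and ?P = "percolation G p"
  interpret A: prob_space ?A by (rule prob_space_percolation)
  interpret B: prob_space ?B by (rule prob_space_percolation)
  interpret P: prob_space ?P by (rule prob_space_percolation)
  interpret AB: pair_prob_space ?A ?B ..
  have finE: "finite (edges G)" using G(1) by (rule finite_edges)
  define bad where "bad = {x \<in> space ?A. real (card (large_set k G x)) < 3 * (\<alpha> * real (card (verts G)))}"
  define \<epsilon> where "\<epsilon> = exp (real (card (verts G)) * (1 / real k - b ^ L * (c * \<alpha> / (2 * real L))))"
  let ?N = "{\<omega> \<in> space ?P. \<not> giant \<alpha> G \<omega>}"
  have N: "?N \<in> sets ?P" using sets_percolation_finite[OF finE] by blast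
  have bad: "bad \<in> sets ?A" unfolding bad_def using sets_percolation_finite[OF finE] by blast
  have "1 - prob_giant_component G p \<alpha> = P.prob ?N"
    unfolding prob_giant_component_def giant_def
    by (rule P.prob_neg[symmetric]) (use sets_percolation_finite[OF finE] in blast)
  also have "ennreal \<dots> = emeasure (distr (?A \<Otimes>\<^sub>M ?B) ?P (union_config G)) ?N"
    by (simp only: distr_union_config[OF ab] P.emeasure_eq_measure)
  also have "\<dots> = emeasure (?A \<Otimes>\<^sub>M ?B) (union_config G -` ?N \<inter> space (?A \<Otimes>\<^sub>M ?B))"
    by (rule emeasure_distr[OF measurable_union_config N])
  also have "\<dots> = (\<integral>\<^sup>+x. emeasure ?B (Pair x -` (union_config G -` ?N \<inter> space (?A \<Otimes>\<^sub>M ?B))) \<partial>?A)"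
    by (rule B.emeasure_pair_measure_alt) (rule measurable_sets[OF measurable_union_config N])
  also have "\<dots> \<le> (\<integral>\<^sup>+x. indicator bad x + ennreal \<epsilon> \<partial>?A)"
  proof (rule nn_integral_mono)
    fix x assume x: "x \<in> space ?A"
    have "Pair x -` (union_config G -` ?N \<inter> space (?A \<Otimes>\<^sub>M ?B)) \<subseteq>
        {y \<in> space ?B. \<not> giant \<alpha> G (union_config G (x, y))}"
      by (auto simp: space_pair_measure)
    then have le: "emeasure ?B (Pair x -` (union_config G -` ?N \<inter> space (?A \<Otimes>\<^sub>M ?B)))
        \<le> emeasure ?B {y \<in> space ?B. \<not> giant \<alpha> G (union_config G (x, y))}"
      using sets_percolation_finite[OF finE] by (intro emeasure_mono) blast+
    show "emeasure ?B (Pair x -` (union_config G -` ?N \<inter> space (?A \<Otimes>\<^sub>M ?B))) \<le> indicator bad x + ennreal \<epsilon>"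
    proof (cases "x \<in> bad")
      case True
      have "emeasure ?B (Pair x -` (union_config G -` ?N \<inter> space (?A \<Otimes>\<^sub>M ?B))) \<le> 1"
        by (rule B.emeasure_le_1)
      also have "1 \<le> 1 + ennreal \<epsilon>" by simp
      finally show ?thesis using True by simp
    next
      case False
      then have "B.prob {y \<in> space ?B. \<not> giant \<alpha> G (union_config G (x, y))} \<le> \<epsilon>"
        unfolding \<epsilon>_def using x by (intro prob_no_giant_sprinkled[OF G \<alpha> L ab(3,4) k]) (simp add: bad_def)
      then have "emeasure ?B {y \<in> space ?B. \<not> giant \<alpha> G (union_config G (x, y))} \<le> ennreal \<epsilon>"
        by (simp add: B.emeasure_eq_measure ennreal_leI)
      with le have "emeasure ?B (Pair x -` (union_config G -` ?N \<inter> space (?A \<Otimes>\<^sub>M ?B))) \<le> ennreal \<epsilon>"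
        by (rule order_trans)
      then show ?thesis using False by simp
    qed
  qed
  also have "\<dots> = ennreal (A.prob bad + \<epsilon>)"
    using bad by (simp add: nn_integral_add A.emeasure_space_1 A.emeasure_eq_measure A.prob_space \<epsilon>_def)
  finally have "1 - prob_giant_component G p \<alpha> \<le> A.prob bad + \<epsilon>"
    by (subst (asm) ennreal_le_iff) (simp_all add: \<epsilon>_def)
  then show ?thesis by (simp add: bad_def \<epsilon>_def)
qed


subsection \<open>Moments of the number of vertices in large components\<close>

text \<open>The identity matches the two open subgraphs on the ball of radius \<open>k\<close>,
  where the event is decided.\<close>

lemma large_comp_local:
  assumes G: "simple_graph G" "degrees_at_most G \<Delta>" "v \<in> verts G"
    and xy: "\<And>e. e \<in> edges G \<Longrightarrow> e \<subseteq> nball G v k \<Longrightarrow> x e = y e"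
  shows "large_comp k (open_graph G x) v = large_comp k (open_graph G y) v"
proof -
  have "id ` nball (open_graph G x) v k = nball (open_graph G y) v k"
    by (rule ball_iso_image_nball[OF ball_iso_refl[of k G v]]) (auto simp: edges_open_graph xy)
  then show ?thesis
    using large_comp_iff_nball[OF simple_open_graph[OF G(1)] degrees_open_graph[OF G(2)], of v _ k] G(3)
    by simp
qed

lemma card_large_set:
  "finite (verts G) \<Longrightarrow> real (card (large_set k G \<omega>)) = (\<Sum>v\<in>verts G. of_bool (large_comp k (open_graph G \<omega>) v))"
  by (simp add: large_set_def of_bool_def sum.If_cases Int_def)

lemma
  assumes "finite_graph G"
  shows percolation_measurable: "f \<in> borel_measurable (percolation G p)"
    and percolation_integrable: "(\<And>\<omega>. \<bar>f \<omega>\<bar> \<le> B) \<Longrightarrow> integrable (percolation G p) (f :: _ \<Rightarrow> real)"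
    and expectation_of_bool: "(\<integral>\<omega>. of_bool (Q \<omega>) \<partial>percolation G p) =
      measure (percolation G p) {\<omega> \<in> space (percolation G p). Q \<omega>}"
proof -
  interpret prob_space "percolation G p" by (rule prob_space_percolation)
  have ev: "A \<subseteq> space (percolation G p) \<Longrightarrow> A \<in> events" for A
    using sets_percolation_finite[OF finite_edges[OF assms]] by blast
  show m: "f \<in> borel_measurable (percolation G p)" for f :: "_ \<Rightarrow> real"
    by (rule measurableI) (auto intro: ev)
  show "(\<And>\<omega>. \<bar>f \<omega>\<bar> \<le> B) \<Longrightarrow> integrable (percolation G p) f"
    using m by (intro integrable_const_bound[of _ B]) auto
  let ?A = "{\<omega> \<in> space (percolation G p). Q \<omega>}"
  have "(\<integral>\<omega>. of_bool (Q \<omega>) \<partial>percolation G p) = (\<integral>\<omega>. indicator ?A \<omega> \<partial>percolation G p)"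
    by (intro Bochner_Integration.integral_cong) (auto simp: indicator_def)
  also have "\<dots> = prob (?A \<inter> space (percolation G p))" by (rule Bochner_Integration.integral_indicator)
  also have "?A \<inter> space (percolation G p) = ?A" by blast
  finally show "(\<integral>\<omega>. of_bool (Q \<omega>) \<partial>percolation G p) = prob ?A" .
qed

text \<open>If the balls of radius \<open>k\<close> met, the centres would be within distance
  \<open>k + k\<close>. So the two events are decided by disjoint sets of edges.\<close>

lemma large_prob_indep:
  assumes G: "finite_graph G" "degrees_at_most G \<Delta>" and uv: "u \<in> verts G" "v \<in> verts G"
    and far: "v \<notin> nball G u (k + k)"
  shows "measure (percolation G p) {\<omega> \<in> space (percolation G p).
      large_comp k (open_graph G \<omega>) u \<and> large_comp k (open_graph G \<omega>) v} =
    large_prob G p k u * large_prob G p k v"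
proof -
  have sG: "simple_graph G" using G(1) by (simp add: finite_graph_def)
  have "u \<noteq> v" using far by auto
  have "nball G u k \<inter> nball G v k = {}"
    using far nball_trans nball_sym by fast
  define K where "K w = {e \<in> edges G. e \<subseteq> nball G w k}" for w
  have "K u \<inter> K v = {}"
  proof (rule ccontr)
    assume "K u \<inter> K v \<noteq> {}"
    then obtain e where e: "e \<in> edges G" "e \<subseteq> nball G u k" "e \<subseteq> nball G v k" unfolding K_def by blast
    then have "e = {}" using \<open>nball G u k \<inter> nball G v k = {}\<close> by blast
    then show False using e(1) sG by (auto simp: simple_graph_def)
  qed
  have "measure (PiM (edges G) (\<lambda>_. bern p)) {\<omega> \<in> space (PiM (edges G) (\<lambda>_. bern p)).
        \<forall>w\<in>{u, v}. large_comp k (open_graph G \<omega>) w} =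
      (\<Prod>w\<in>{u, v}. measure (PiM (edges G) (\<lambda>_. bern p)) {\<omega> \<in> space (PiM (edges G) (\<lambda>_. bern p)).
        large_comp k (open_graph G \<omega>) w})"
  proof (rule prob_indep_finite[where K = K])
    show "finite (edges G)" using G(1) by (rule finite_edges)
    show "disjoint_family_on K {u, v}"
      using \<open>K u \<inter> K v = {}\<close> by (auto simp: disjoint_family_on_def)
    fix j and x y :: "'a set \<Rightarrow> bool" assume "j \<in> {u, v}" and xy: "\<And>i. i \<in> K j \<Longrightarrow> x i = y i"
    then have "j \<in> verts G" using uv by blast
    then show "large_comp k (open_graph G x) j = large_comp k (open_graph G y) j"
      using xy by (intro large_comp_local[OF sG G(2)]) (auto simp: K_def)
  qed (auto simp: K_def)
  then show ?thesis using \<open>u \<noteq> v\<close> by (simp add: large_prob_def percolation_def)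
qed

text \<open>Second moment method. Only pairs within distance \<open>k + k\<close> can be correlated,
  and there are at most \<open>n * Suc \<Delta> ^ (k + k)\<close> of them, so the variance is linear
  in \<open>n\<close>.\<close>

lemma large_set_concentrated:
  assumes G: "finite_graph G" "degrees_at_most G \<Delta>" and \<delta>: "0 < \<delta>"
    and mean: "2 * (\<delta> * real (card (verts G))) \<le> (\<Sum>v\<in>verts G. large_prob G p k v)"
  shows "measure (percolation G p) {\<omega> \<in> space (percolation G p).
      real (card (large_set k G \<omega>)) < \<delta> * real (card (verts G))}
    \<le> real (Suc \<Delta> ^ (k + k)) / (\<delta>\<^sup>2 * real (card (verts G)))"
proof -
  let ?M = "percolation G p" and ?V = "verts G" and ?n = "real (card (verts G))"
  let ?Q = "\<lambda>\<omega> v. large_comp k (open_graph G \<omega>) v"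
  let ?P = "\<lambda>v. large_prob G p k v"
  interpret prob_space ?M by (rule prob_space_percolation)
  have sG: "simple_graph G" and fin: "finite ?V" "?V \<noteq> {}" using G(1) by (auto simp: finite_graph_def)
  have n: "0 < ?n" using fin by (simp add: card_gt_0_iff)
  define N where "N \<omega> = real (card (large_set k G \<omega>))" for \<omega>
  define f where "f v \<omega> = of_bool (?Q \<omega> v) - ?P v" for v \<omega>
  have ob: "integrable ?M (\<lambda>\<omega>. of_bool (Q \<omega>) :: real)" for Q
    by (rule percolation_integrable[OF G(1), of _ 1]) simp
  have E: "expectation (\<lambda>\<omega>. of_bool (?Q \<omega> v)) = ?P v" for v
    by (simp add: expectation_of_bool[OF G(1)] large_prob_def)
  have N_eq: "N \<omega> = (\<Sum>v\<in>?V. of_bool (?Q \<omega> v))" for \<omega>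
    unfolding N_def using fin(1) by (rule card_large_set)
  have EN: "expectation N = (\<Sum>v\<in>?V. ?P v)" unfolding N_eq
    by (subst Bochner_Integration.integral_sum) (simp_all add: ob E)
  have N_bound: "\<bar>N \<omega>\<bar> \<le> ?n" for \<omega>
    unfolding N_def large_set_def using fin by (auto intro: card_mono)
  have ff: "integrable ?M (\<lambda>\<omega>. f u \<omega> * f v \<omega>)" for u v
  proof (rule percolation_integrable[OF G(1)])
    fix \<omega>
    have "\<bar>f w \<omega>\<bar> \<le> 1" for w using large_prob_bounds[of G p k w] by (auto simp: f_def of_bool_def)
    then show "\<bar>f u \<omega> * f v \<omega>\<bar> \<le> 1" unfolding abs_mult by (intro mult_le_one) auto
  qed
  have cov: "expectation (\<lambda>\<omega>. f u \<omega> * f v \<omega>) \<le> of_bool (v \<in> nball G u (k + k))"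
    if uv: "u \<in> ?V" "v \<in> ?V" for u v
  proof -
    have "expectation (\<lambda>\<omega>. f u \<omega> * f v \<omega>) = expectation (\<lambda>\<omega>. of_bool (?Q \<omega> u \<and> ?Q \<omega> v)
        - ?P u * of_bool (?Q \<omega> v) - ?P v * of_bool (?Q \<omega> u) + ?P u * ?P v)"
      by (intro Bochner_Integration.integral_cong refl) (simp add: f_def of_bool_conj algebra_simps)
    also have "\<dots> = prob {\<omega> \<in> space ?M. ?Q \<omega> u \<and> ?Q \<omega> v} - ?P u * ?P v - ?P v * ?P u + ?P u * ?P v"
      using ob by (simp add: large_prob_def expectation_of_bool[OF G(1)] prob_space)
    also have "\<dots> = prob {\<omega> \<in> space ?M. ?Q \<omega> u \<and> ?Q \<omega> v} - ?P u * ?P v" by simp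
    also have "\<dots> \<le> of_bool (v \<in> nball G u (k + k))"
    proof (cases "v \<in> nball G u (k + k)")
      case True
      have "0 \<le> ?P u * ?P v" by (intro mult_nonneg_nonneg large_prob_bounds)
      moreover have "prob {\<omega> \<in> space ?M. ?Q \<omega> u \<and> ?Q \<omega> v} \<le> 1" by (rule prob_le_1)
      ultimately show ?thesis using True by (simp only: of_bool_eq)
    next
      case False
      then show ?thesis using large_prob_indep[OF G uv, of k p] by simp
    qed
    finally show ?thesis .
  qed
  have "expectation (\<lambda>\<omega>. (N \<omega> - expectation N)\<^sup>2) = expectation (\<lambda>\<omega>. \<Sum>u\<in>?V. \<Sum>v\<in>?V. f u \<omega> * f v \<omega>)"
    unfolding EN by (intro Bochner_Integration.integral_cong refl)
      (simp add: N_eq f_def sum_subtractf[symmetric] power2_eq_square sum_product)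
  also have "\<dots> = (\<Sum>u\<in>?V. \<Sum>v\<in>?V. expectation (\<lambda>\<omega>. f u \<omega> * f v \<omega>))"
    using ff by (subst Bochner_Integration.integral_sum)
      (auto intro!: sum.cong Bochner_Integration.integral_sum Bochner_Integration.integrable_sum)
  also have "\<dots> \<le> (\<Sum>u\<in>?V. \<Sum>v\<in>?V. of_bool (v \<in> nball G u (k + k)))"
    using cov by (intro sum_mono)
  also have "\<dots> \<le> (\<Sum>u\<in>?V. real (Suc \<Delta> ^ (k + k)))"
  proof (rule sum_mono)
    fix u
    have "(\<Sum>v\<in>?V. of_bool (v \<in> nball G u (k + k))) = real (card {v \<in> ?V. v \<in> nball G u (k + k)})"
      using fin by (simp add: of_bool_def sum.If_cases Int_def)
    also have "card {v \<in> ?V. v \<in> nball G u (k + k)} \<le> card (nball G u (k + k))"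
      using finite_nball[OF sG G(2)] by (intro card_mono) auto
    then have "real (card {v \<in> ?V. v \<in> nball G u (k + k)}) \<le> real (Suc \<Delta> ^ (k + k))"
      using card_nball_le[OF sG G(2), of u "k + k"] by (metis le_trans of_nat_mono)
    finally show "(\<Sum>v\<in>?V. of_bool (v \<in> nball G u (k + k))) \<le> real (Suc \<Delta> ^ (k + k))" .
  qed
  finally have var: "expectation (\<lambda>\<omega>. (N \<omega> - expectation N)\<^sup>2) \<le> ?n * real (Suc \<Delta> ^ (k + k))" by simp
  \<comment> \<open>The factor 2 in \<open>mean\<close> is used here: a value below
    \<open>\<delta> * n\<close> deviates from the mean by at least
    \<open>\<delta> * n\<close>.\<close>
  have "prob {\<omega> \<in> space ?M. N \<omega> < \<delta> * ?n} \<le> prob {\<omega> \<in> space ?M. \<delta> * ?n \<le> \<bar>N \<omega> - expectation N\<bar>}"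
  proof (rule finite_measure_mono)
    show "{\<omega> \<in> space ?M. \<delta> * ?n \<le> \<bar>N \<omega> - expectation N\<bar>} \<in> events"
      using sets_percolation_finite[OF finite_edges[OF G(1)]] by blast
  qed (use mean EN in auto)
  also have "\<dots> \<le> expectation (\<lambda>\<omega>. (N \<omega> - expectation N)\<^sup>2) / (\<delta> * ?n)\<^sup>2"
  proof (rule Chebyshev_inequality)
    show "random_variable borel N" by (rule percolation_measurable[OF G(1)])
    show "integrable ?M (\<lambda>\<omega>. (N \<omega>)\<^sup>2)"
      by (rule percolation_integrable[OF G(1), of _ "?n\<^sup>2"])
        (use N_bound in \<open>simp add: abs_le_square_iff[symmetric]\<close>)
  qed (use \<delta> n in simp)
  also have "\<dots> \<le> (?n * real (Suc \<Delta> ^ (k + k))) / (\<delta> * ?n)\<^sup>2"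
    using var by (intro divide_right_mono) auto
  also have "\<dots> = real (Suc \<Delta> ^ (k + k)) / (\<delta>\<^sup>2 * ?n)"
    using n by (simp add: power2_eq_square)
  finally show ?thesis by (simp add: N_def)
qed

text \<open>All vertices of a giant component are counted by \<open>N\<close>, because
  \<open>k \<le> \<alpha> * n\<close>. Markov's inequality for \<open>N\<close> concludes.\<close>

lemma prob_giant_le:
  assumes G: "finite_graph G" and \<alpha>: "0 < \<alpha>" "real k \<le> \<alpha> * real (card (verts G))"
  shows "prob_giant_component G p \<alpha> \<le>
    (\<Sum>v\<in>verts G. large_prob G p k v) / (\<alpha> * real (card (verts G)))"
proof -
  let ?M = "percolation G p" and ?V = "verts G" and ?n = "real (card (verts G))"
  interpret prob_space ?M by (rule prob_space_percolation)
  have fin: "finite ?V" "?V \<noteq> {}" using G by (auto simp: finite_graph_def)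
  have n: "0 < \<alpha> * ?n" using fin \<alpha>(1) by (simp add: card_gt_0_iff)
  define N where "N \<omega> = real (card (large_set k G \<omega>))" for \<omega>
  have ev: "{\<omega> \<in> space ?M. Q \<omega>} \<in> events" for Q
    using sets_percolation_finite[OF finite_edges[OF G]] by blast
  have N_eq: "N \<omega> = (\<Sum>v\<in>?V. of_bool (large_comp k (open_graph G \<omega>) v))" for \<omega>
    unfolding N_def using fin(1) by (rule card_large_set)
  have "integrable ?M (\<lambda>\<omega>. of_bool (Q \<omega>) :: real)" for Q
    by (rule percolation_integrable[OF G, of _ 1]) simp
  then have EN: "expectation N = (\<Sum>v\<in>?V. large_prob G p k v)" unfolding N_eq
    by (subst Bochner_Integration.integral_sum) (simp_all add: expectation_of_bool[OF G] large_prob_def)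
  have "prob_giant_component G p \<alpha> \<le> prob {\<omega> \<in> space ?M. \<alpha> * ?n \<le> N \<omega>}"
    unfolding prob_giant_component_def
  proof (rule finite_measure_mono[OF _ ev], safe)
    fix \<omega> C assume C: "C \<in> graph_components (open_graph G \<omega>)" "\<alpha> * ?n \<le> real (card C)"
    then obtain v where v: "C = graph_component (open_graph G \<omega>) v" by (auto simp: graph_components_def)
    have "k \<le> card C" using C(2) \<alpha>(2) by linarith
    then have "C \<subseteq> large_set k G \<omega>"
      using graph_component_eq[of _ "open_graph G \<omega>" v] graph_component_subset[of "open_graph G \<omega>" v] v
      by (auto simp: large_set_def large_comp_def)
    then have "card C \<le> card (large_set k G \<omega>)"
      using fin by (intro card_mono) (auto simp: large_set_def)
    then show "\<alpha> * ?n \<le> N \<omega>" using C(2) by (simp add: N_def)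
  qed
  also have "\<dots> \<le> expectation N / (\<alpha> * ?n)"
  proof (rule integral_Markov_inequality_measure[where A = "{}"])
    have "\<bar>N \<omega>\<bar> \<le> ?n" for \<omega>
      unfolding N_def large_set_def using fin by (auto intro: card_mono)
    then show "integrable ?M N" by (rule percolation_integrable[OF G])
  qed (use n in \<open>auto simp: N_def\<close>)
  finally show ?thesis by (simp add: EN)
qed


subsection \<open>Passing to the local limit\<close>

lemma infinite_prob_le_large_prob:
  assumes "countable (verts G)" "simple_graph G" "v \<in> verts G"
  shows "infinite_prob G p v \<le> large_prob G p k v"
proof -
  interpret prob_space "percolation G p" by (rule prob_space_percolation)
  show ?thesis using pred_large_comp[OF assms, where p = p and k = k]
    unfolding infinite_prob_def large_prob_def
    by (intro finite_measure_mono) (auto simp: pred_def large_comp_def)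
qed

text \<open>\<open>g\<close> is a measurable substitute for the percolation probability at the root,
  obtained by dominated convergence from the substitutes for \<open>large_prob\<close>. The
  inequality against every \<open>t j\<close> gives a lower bound uniform in the cutoff. The cutoff
  is \<open>Suc j\<close> because \<open>local_limit\<close> asks for a positive radius.\<close>

lemma average_large_prob_limit:
  fixes G :: "nat \<Rightarrow> 'v graph"
  assumes \<mu>: "random_rooted_graph \<Delta> \<mu>" and conv: "locally_weakly_converges G \<mu>"
    and G: "\<And>n. n \<ge> 1 \<Longrightarrow> finite_graph (G n)" "\<And>n. n \<ge> 1 \<Longrightarrow> degrees_at_most (G n) \<Delta>"
  obtains t :: "nat \<Rightarrow> real" and g where "integrable \<mu> g"
    "AE X in \<mu>. g X = infinite_prob (fst (rep X)) p (snd (rep X))"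
    "t \<longlonglongrightarrow> integral\<^sup>L \<mu> g" "\<And>j. integral\<^sup>L \<mu> g \<le> t j"
    "\<And>j. (\<lambda>n. (\<Sum>v\<in>verts (G n). large_prob (G n) p (Suc j) v) / card (verts (G n))) \<longlonglongrightarrow> t j"
proof -
  interpret prob_space \<mu> using \<mu> by (simp add: random_rooted_graph_def)
  have space: "space \<mu> = graph_space \<Delta>" using \<mu> by (rule space_random_rooted_graph)
  let ?L = "\<lambda>j X. large_prob (fst (rep X)) p j (snd (rep X))"
  let ?I = "\<lambda>X. infinite_prob (fst (rep X)) p (snd (rep X))"
  define Q where "Q j F \<longleftrightarrow> F \<in> borel_measurable \<mu> \<and> integrable \<mu> F \<and> (AE X in \<mu>. F X = ?L (Suc j) X) \<and>
      (\<lambda>n. (\<Sum>v\<in>verts (G n). large_prob (G n) p (Suc j) v) / card (verts (G n))) \<longlonglongrightarrow> integral\<^sup>L \<mu> F" for j F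
  have "\<exists>F. Q j F" for j
  proof (rule local_limit[OF \<mu> conv _ G, where k = "Suc j" and F = "\<lambda>H v. large_prob H p (Suc j) v"
        and F' = "\<lambda>H v. large_prob H p (Suc j) v"])
    show "large_prob H p (Suc j) v = large_prob H' p (Suc j) v'"
      if "valid \<Delta> H v" "valid \<Delta> H' v'" "ball_iso (Suc j) H v H' v' f"
      for H :: "'v graph" and v and H' :: "nat graph" and v' f
      using that by (intro large_prob_ball_iso[where \<Delta> = \<Delta> and f = f]) (simp_all add: valid_def)
    show "large_prob H p (Suc j) v = large_prob H' p (Suc j) v'"
      if "valid \<Delta> H v" "valid \<Delta> H' v'" "ball_iso (Suc j) H v H' v' f"
      for H :: "nat graph" and v and H' :: "nat graph" and v' f
      using that by (intro large_prob_ball_iso[where \<Delta> = \<Delta> and f = f]) (simp_all add: valid_def)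
  qed (auto simp: Q_def)
  then obtain F where "\<And>j. Q j (F j)" by metis
  then have F: "\<And>j. F j \<in> borel_measurable \<mu>" "\<And>j. integrable \<mu> (F j)"
      "\<And>j. AE X in \<mu>. F j X = ?L (Suc j) X"
      "\<And>j. (\<lambda>n. (\<Sum>v\<in>verts (G n). large_prob (G n) p (Suc j) v) / card (verts (G n))) \<longlonglongrightarrow> integral\<^sup>L \<mu> (F j)"
    unfolding Q_def by simp_all
  have cnt: "countable (verts (fst (rep X)))" for X by simp
  have rep: "simple_graph (fst (rep X))" "snd (rep X) \<in> verts (fst (rep X))" if "X \<in> space \<mu>" for X
    using rep_valid[of X \<Delta>] that by (auto simp: space valid_def)
  have AE_F: "AE X in \<mu>. \<forall>j. F j X = ?L (Suc j) X" using F(3) by (simp add: AE_all_countable)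
  \<comment> \<open>Defined from the measurable \<open>F j\<close>, so that measurability is
    automatic; the identification with \<open>?I\<close> holds almost everywhere.\<close>
  define g where "g X = lim (\<lambda>j. F j X)" for X
  have g_meas: "g \<in> borel_measurable \<mu>" unfolding g_def
    by (rule borel_measurable_lim_metric) (rule F(1))
  have tendsto: "AE X in \<mu>. (\<lambda>j. F j X) \<longlonglongrightarrow> ?I X"
    using AE_F AE_space
  proof eventually_elim
    case (elim X)
    have "(\<lambda>j. ?L (Suc j) X) \<longlonglongrightarrow> ?I X"
      by (rule LIMSEQ_Suc[OF large_prob_tendsto[OF cnt rep[OF elim(2)]]])
    then show ?case using elim(1) by simp
  qed
  then have g_eq: "AE X in \<mu>. g X = ?I X"
    by eventually_elim (simp add: g_def limI)
  have g_lim: "AE X in \<mu>. (\<lambda>j. F j X) \<longlonglongrightarrow> g X"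
    using tendsto g_eq by eventually_elim simp
  have bound: "AE X in \<mu>. norm (F j X) \<le> 1" for j
    using F(3)[of j] by eventually_elim (simp add: large_prob_bounds)
  have int_lim: "(\<lambda>j. integral\<^sup>L \<mu> (F j)) \<longlonglongrightarrow> integral\<^sup>L \<mu> g"
    by (rule integral_dominated_convergence[OF g_meas F(1) _ g_lim bound]) simp
  have int_g: "integrable \<mu> g"
    by (rule integrable_dominated_convergence[OF g_meas F(1) _ g_lim bound]) simp
  have "integral\<^sup>L \<mu> g \<le> integral\<^sup>L \<mu> (F j)" for j
  proof (rule integral_mono_AE[OF int_g F(2)])
    show "AE X in \<mu>. g X \<le> F j X"
      using g_eq AE_F AE_space
      by eventually_elim (simp add: infinite_prob_le_large_prob[OF cnt rep(1) rep(2)])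
  qed
  then show thesis using that[OF int_g g_eq int_lim _ F(4)] by blast
qed

text \<open>In an infinite connected graph of bounded degree every ball of radius
  \<open>Suc m\<close> has at least \<open>Suc m\<close> vertices. The proportion of vertices of
  \<open>G n\<close> with this property therefore tends to 1, and a single one already makes
  \<open>G n\<close> that large.\<close>

lemma card_verts_tendsto:
  fixes G :: "nat \<Rightarrow> 'v graph"
  assumes \<mu>: "random_rooted_graph \<Delta> \<mu>" and conv: "locally_weakly_converges G \<mu>"
    and G: "\<And>n. n \<ge> 1 \<Longrightarrow> finite_graph (G n)" "\<And>n. n \<ge> 1 \<Longrightarrow> degrees_at_most (G n) \<Delta>"
    and inf: "almost_surely_infinite \<mu>"
  shows "filterlim (\<lambda>n. real (card (verts (G n)))) at_top sequentially"
proof -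
  interpret prob_space \<mu> using \<mu> by (simp add: random_rooted_graph_def)
  have space: "space \<mu> = graph_space \<Delta>" using \<mu> by (rule space_random_rooted_graph)
  have "eventually (\<lambda>n. Suc m \<le> card (verts (G n))) sequentially" for m
  proof -
    let ?F = "\<lambda>n. (\<Sum>v\<in>verts (G n). of_bool (Suc m \<le> card (nball (G n) v (Suc m)))) / real (card (verts (G n)))"
    obtain Ft where Ft: "Ft \<in> borel_measurable \<mu>" "AE X in \<mu>. Ft X = of_bool (Suc m \<le> card (nball (fst (rep X)) (snd (rep X)) (Suc m)))"
      "?F \<longlonglongrightarrow> integral\<^sup>L \<mu> Ft"
    proof (rule local_limit[OF \<mu> conv _ G, where k = "Suc m" and F = "\<lambda>H v. of_bool (Suc m \<le> card (nball H v (Suc m)))"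
        and F' = "\<lambda>H v. of_bool (Suc m \<le> card (nball H v (Suc m)))"])
    qed (auto dest!: ball_iso_card_nball simp del: nball.simps)
    have "AE X in \<mu>. Ft X = 1"
      using Ft(2) inf[unfolded almost_surely_infinite_def] AE_space
    proof eventually_elim
      case (elim X)
      have v: "valid \<Delta> (fst (rep X)) (snd (rep X))" "connected_graph (fst (rep X))"
        using rep_valid[of X \<Delta>] elim(3) space by auto
      then have "graph_component (fst (rep X)) (snd (rep X)) = verts (fst (rep X))"
        by (auto simp: graph_component_def connected_graph_def valid_def)
      then have "large_comp (Suc m) (fst (rep X)) (snd (rep X))" using elim(2) by (simp add: large_comp_def)
      then show ?case using large_comp_iff_nball[of "fst (rep X)" \<Delta>] v elim(1) by (simp add: valid_def)
    qed
    then have "integral\<^sup>L \<mu> Ft = integral\<^sup>L \<mu> (\<lambda>_. 1)"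
      using Ft(1) by (intro integral_cong_AE) simp_all
    then have "?F \<longlonglongrightarrow> 1" using Ft(3) by (simp add: prob_space)
    then have "eventually (\<lambda>n. 0 < ?F n) sequentially" by (rule order_tendstoD) simp
    then show ?thesis using eventually_ge_at_top[of 1]
    proof eventually_elim
      case (elim n)
      have "\<exists>v\<in>verts (G n). Suc m \<le> card (nball (G n) v (Suc m))"
      proof (rule ccontr)
        assume "\<not> (\<exists>v\<in>verts (G n). Suc m \<le> card (nball (G n) v (Suc m)))"
        then have "(\<Sum>v\<in>verts (G n). of_bool (Suc m \<le> card (nball (G n) v (Suc m))) :: real) = 0"
          by (intro sum.neutral) auto
        then show False using elim(1) by simp
      qed
      then obtain v where v: "v \<in> verts (G n)" "Suc m \<le> card (nball (G n) v (Suc m))" by blast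
      have "card (nball (G n) v (Suc m)) \<le> card (verts (G n))"
        using G(1)[OF elim(2)] nball_subset_verts[of "G n" v "Suc m"] v(1)
        by (intro card_mono) (simp_all add: finite_graph_def del: nball.simps)
      then show ?case using v(2) by simp
    qed
  qed
  then show ?thesis unfolding filterlim_at_top_gt[where c = 0]
  proof (intro allI impI)
    fix Z :: real assume "0 < Z"
    have *: "\<And>m. eventually (\<lambda>n. Suc m \<le> card (verts (G n))) sequentially" by fact
    obtain m where "Z \<le> real m" using real_arch_simple by blast
    from *[of m] show "eventually (\<lambda>n. Z \<le> real (card (verts (G n)))) sequentially"
      by eventually_elim (use \<open>Z \<le> real m\<close> in linarith)
  qed
qed


subsection \<open>The threshold\<close>

lemma critical_prob_nonneg:
  assumes "countable (verts G)" "simple_graph G" "connected_graph G" "infinite (verts G)"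
  shows "0 \<le> critical_prob G"
  unfolding critical_prob_def
proof (rule cInf_greatest)
  show "{p \<in> {0..1}. prob_infinite_component G p > 0} \<noteq> {}"
    using prob_infinite_component_1[OF assms] by (auto intro!: exI[of _ 1])
qed auto

text \<open>The constant \<open>pc\<close> is introduced by a hypothesis: that the critical
  probability is almost surely constant is a separate result.\<close>

theorem corollary1p2:
  fixes \<Delta> :: nat and c p pc :: real
    and G :: "nat \<Rightarrow> 'v graph"
    and \<mu> :: "nat rooted set measure"
  assumes "\<Delta> > 0" and "c > 0"
    and "\<And>n. n \<ge> 1 \<Longrightarrow> finite_graph (G n)"
    and "\<And>n. n \<ge> 1 \<Longrightarrow> degrees_at_most (G n) \<Delta>"
    and "\<And>n. n \<ge> 1 \<Longrightarrow> cheeger (G n) \<ge> ereal c"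
    and "random_rooted_graph \<Delta> \<mu>"
    and "almost_surely_infinite \<mu>"
    and "locally_weakly_converges G \<mu>"
    and "AE X in \<mu>. critical_prob (fst (rep X)) = pc"
    and "0 \<le> p" and "p \<le> 1"
  shows "(p < pc \<longrightarrow>
            (\<forall>\<alpha>>0. (\<lambda>n. prob_giant_component (G n) p \<alpha>) \<longlonglongrightarrow> 0)) \<and>
         (p > pc \<longrightarrow>
            (\<exists>\<alpha>>0. (\<lambda>n. prob_giant_component (G n) p \<alpha>) \<longlonglongrightarrow> 1))"
proof (intro conjI impI allI)
  interpret prob_space \<mu> using assms(6) by (simp add: random_rooted_graph_def)
  have space: "space \<mu> = graph_space \<Delta>" using assms(6) by (rule space_random_rooted_graph)
  have rep: "simple_graph (fst (rep X))" "connected_graph (fst (rep X))" "snd (rep X) \<in> verts (fst (rep X))"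
    if "X \<in> space \<mu>" for X
    using rep_valid[of X \<Delta>] that by (auto simp: space valid_def)
  have cnt: "countable (verts (fst (rep X)))" for X by simp
  have large: "filterlim (\<lambda>n. real (card (verts (G n)))) at_top sequentially"
    by (rule card_verts_tendsto[OF assms(6,8,3,4,7)])
  have giant_bounds: "0 \<le> prob_giant_component (G n) p \<alpha>" "prob_giant_component (G n) p \<alpha> \<le> 1" for n \<alpha>
    unfolding prob_giant_component_def
    by (auto intro: prob_space.prob_le_1[OF prob_space_percolation])
  {
    fix \<alpha> :: real assume p: "p < pc" and \<alpha>: "\<alpha> > 0"
    obtain t g where g: "integrable \<mu> g" "AE X in \<mu>. g X = infinite_prob (fst (rep X)) p (snd (rep X))"
      "t \<longlonglongrightarrow> integral\<^sup>L \<mu> g" "\<And>j. integral\<^sup>L \<mu> g \<le> t j"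
      "\<And>j. (\<lambda>n. (\<Sum>v\<in>verts (G n). large_prob (G n) p (Suc j) v) / card (verts (G n))) \<longlonglongrightarrow> t j"
      by (rule average_large_prob_limit[OF assms(6,8,3,4), where p = p]) (assumption+, rule that)
    have "AE X in \<mu>. g X = 0"
      using g(2) assms(9) AE_space
      by eventually_elim (use p assms(10,11) in \<open>simp add: infinite_prob_subcritical[OF cnt rep(1,3)]\<close>)
    then have "integral\<^sup>L \<mu> g = 0"
      by (rule integral_eq_zero_AE)
    then have t: "t \<longlonglongrightarrow> 0" using g(3) by simp
    show "(\<lambda>n. prob_giant_component (G n) p \<alpha>) \<longlonglongrightarrow> 0"
    proof (rule order_tendstoI)
      fix e :: real assume "e < 0"
      then show "eventually (\<lambda>n. e < prob_giant_component (G n) p \<alpha>) sequentially"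
        using giant_bounds(1) by (intro always_eventually) (meson less_le_trans)
    next
      fix e :: real assume e: "0 < e"
      \<comment> \<open>Markov's inequality will divide the mean proportion by
        \<open>\<alpha>\<close>, whence the target \<open>\<alpha> * e\<close>.\<close>
      have "eventually (\<lambda>j. t j < \<alpha> * e) sequentially"
        by (rule order_tendstoD(2)[OF t]) (simp add: \<alpha> e)
      then obtain j where j: "t j < \<alpha> * e" by (meson eventually_happens' sequentially_bot)
      have "eventually (\<lambda>n. real (Suc j) / \<alpha> \<le> real (card (verts (G n)))) sequentially"
        using large by (simp add: filterlim_at_top)
      then show "eventually (\<lambda>n. prob_giant_component (G n) p \<alpha> < e) sequentially"
        using order_tendstoD(2)[OF g(5) j] eventually_ge_at_top[of 1]
      proof eventually_elim
        case (elim n)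
        have k: "real (Suc j) \<le> \<alpha> * real (card (verts (G n)))"
          using elim(1) \<alpha> by (simp add: pos_divide_le_eq mult.commute)
        have "prob_giant_component (G n) p \<alpha> \<le>
            (\<Sum>v\<in>verts (G n). large_prob (G n) p (Suc j) v) / (\<alpha> * real (card (verts (G n))))"
          by (rule prob_giant_le[OF assms(3)[OF elim(3)] \<alpha> k])
        also have "\<dots> = (\<Sum>v\<in>verts (G n). large_prob (G n) p (Suc j) v) / real (card (verts (G n))) / \<alpha>"
          by (simp add: mult.commute)
        also have "\<dots> < e" using elim(2) \<alpha> by (simp only: pos_divide_less_eq) (simp add: mult.commute)
        finally show ?case .
      qed
    qed
  }
  {
    assume p: "pc < p"
    \<comment> \<open>Makes \<open>a\<close> below an admissible parameter. A statement free of
      \<open>X\<close> that holds almost surely simply holds.\<close>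
    have "AE X in \<mu>. 0 \<le> pc"
      using assms(9) assms(7)[unfolded almost_surely_infinite_def] AE_space
      by eventually_elim (use critical_prob_nonneg[OF cnt rep(1,2)] in auto)
    then have pc: "0 \<le> pc" by (simp add: AE_const)
    \<comment> \<open>Strictly between: above \<open>pc\<close> for percolation at the root, below
      \<open>p\<close> to leave room for sprinkling.\<close>
    define a where "a = (pc + p) / 2"
    have a: "pc < a" "0 \<le> a" "a < p" "a < 1" using p pc assms(11) by (auto simp: a_def)
    define b where "b = (p - a) / (1 - a)"
    have b: "0 < b" "b \<le> 1" using a assms(11) by (auto simp: b_def)
    have pab: "p = a + (1 - a) * b" using a by (simp add: b_def)
    obtain t g where g: "integrable \<mu> g" "AE X in \<mu>. g X = infinite_prob (fst (rep X)) a (snd (rep X))"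
      "t \<longlonglongrightarrow> integral\<^sup>L \<mu> g" "\<And>j. integral\<^sup>L \<mu> g \<le> t j"
      "\<And>j. (\<lambda>n. (\<Sum>v\<in>verts (G n). large_prob (G n) a (Suc j) v) / card (verts (G n))) \<longlonglongrightarrow> t j"
      by (rule average_large_prob_limit[OF assms(6,8,3,4), where p = a]) (assumption+, rule that)
    have g_pos: "AE X in \<mu>. 0 < g X"
      using g(2) assms(9) assms(7)[unfolded almost_surely_infinite_def] AE_space
      by eventually_elim (use a in \<open>simp add: infinite_prob_supercritical[OF cnt rep(1,2)] rep(3)\<close>)
    define \<theta> where "\<theta> = integral\<^sup>L \<mu> g"
    have "0 \<le> \<theta>" unfolding \<theta>_def by (rule integral_nonneg_AE) (use g_pos in eventually_elim, simp)
    moreover have "\<theta> \<noteq> 0"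
    proof
      assume "\<theta> = 0"
      moreover have "AE X in \<mu>. 0 \<le> g X" using g_pos by eventually_elim simp
      ultimately have "AE X in \<mu>. g X = 0"
        using integral_nonneg_eq_0_iff_AE[OF g(1)] by (simp add: \<theta>_def)
      then have "AE X in \<mu>. False" using g_pos by eventually_elim simp
      then show False by (simp add: AE_const)
    qed
    ultimately have \<theta>: "0 < \<theta>" by simp
    \<comment> \<open>The 12 is 2 for staying above half the limiting mean, 2 for Chebyshev's
      inequality, and 3 for the split.\<close>
    define \<alpha> where "\<alpha> = \<theta> / 12"
    have \<alpha>: "0 < \<alpha>" using \<theta> by (simp add: \<alpha>_def)
    have "0 < c * \<alpha> / 2" using \<alpha> assms(2) by simp
    then obtain L where L: "real \<Delta> < real L * (c * \<alpha> / 2)"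
      using reals_Archimedean3 by blast
    have Lpos: "0 < L" using L by (cases L) auto
    define \<beta> where "\<beta> = b ^ L * (c * \<alpha> / (2 * real L))"
    have \<beta>: "0 < \<beta>" using b \<alpha> assms(2) Lpos by (simp add: \<beta>_def)
    \<comment> \<open>\<open>\<beta>\<close> is already fixed by \<open>\<alpha>\<close>,
      \<open>b\<close> and \<open>L\<close>, so \<open>k\<close> can be taken large enough for the
      entropy \<open>1 / k\<close> of the splits to lose against it.\<close>
    obtain j where j: "inverse (real (Suc j)) < \<beta> / 2" using reals_Archimedean[of "\<beta> / 2"] \<beta> by auto
    define k where "k = Suc j"
    define \<gamma> where "\<gamma> = 1 / real k - \<beta>"
    have \<gamma>: "\<gamma> < 0" using j \<beta> by (simp add: \<gamma>_def k_def inverse_eq_divide)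
    \<comment> \<open>The constant of \<open>large_set_concentrated\<close> for
      \<open>\<delta> = 3 * \<alpha>\<close>; it depends on \<open>k\<close> but not on
      \<open>n\<close>.\<close>
    define D where "D = real (Suc \<Delta> ^ (k + k)) / (3 * \<alpha>)\<^sup>2"
    define err where "err x = D / x + exp (x * \<gamma>)" for x :: real
    have "(err \<longlongrightarrow> 0 + 0) at_top" unfolding err_def
    proof (rule tendsto_add)
      show "((\<lambda>x. D / x) \<longlongrightarrow> 0) at_top"
        by (rule tendsto_divide_0[OF tendsto_const]) (simp add: filterlim_at_top_imp_at_infinity filterlim_ident)
      have "filterlim (\<lambda>x. \<gamma> * x) at_bot at_top"
        by (rule filterlim_tendsto_neg_mult_at_bot[OF tendsto_const \<gamma> filterlim_ident])
      then have "filterlim (\<lambda>x. x * \<gamma>) at_bot at_top" by (simp add: mult.commute)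
      then show "((\<lambda>x. exp (x * \<gamma>)) \<longlongrightarrow> 0) at_top"
        by (rule filterlim_compose[OF exp_at_bot])
    qed
    then have err: "(\<lambda>n. err (real (card (verts (G n))))) \<longlonglongrightarrow> 0"
      using filterlim_compose[OF _ large, of err "nhds 0"] by simp
    \<comment> \<open>The limit \<open>t j\<close> is at least \<open>\<theta>\<close> for every
      \<open>j\<close>, so this late choice of \<open>k\<close> costs nothing.\<close>
    have "eventually (\<lambda>n. \<theta> / 2 < (\<Sum>v\<in>verts (G n). large_prob (G n) a (Suc j) v) / card (verts (G n))) sequentially"
      using g(4)[of j] \<theta> by (intro order_tendstoD(1)[OF g(5)]) (simp add: \<theta>_def)
    then have lower: "eventually (\<lambda>n. 1 - err (real (card (verts (G n)))) \<le> prob_giant_component (G n) p \<alpha>) sequentially"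
      using eventually_ge_at_top[of 1]
    proof eventually_elim
      case (elim n)
      note Gn = assms(3)[OF elim(2)] assms(4)[OF elim(2)] assms(5)[OF elim(2)]
      let ?n = "real (card (verts (G n)))"
      have n: "0 < ?n" using Gn(1) by (simp add: finite_graph_def card_gt_0_iff)
      have mean: "2 * ((3 * \<alpha>) * ?n) \<le> (\<Sum>v\<in>verts (G n). large_prob (G n) a k v)"
        using elim(1) n by (simp add: pos_less_divide_eq \<alpha>_def k_def)
      have "measure (percolation (G n) a) {x \<in> space (percolation (G n) a).
          real (card (large_set k (G n) x)) < 3 * (\<alpha> * ?n)} \<le> D / ?n"
        using large_set_concentrated[OF Gn(1,2) _ mean] \<alpha> by (simp add: D_def mult.assoc)
      moreover have "1 - prob_giant_component (G n) p \<alpha> \<le>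
          measure (percolation (G n) a) {x \<in> space (percolation (G n) a).
            real (card (large_set k (G n) x)) < 3 * (\<alpha> * ?n)} + exp (?n * (1 / real k - \<beta>))"
        unfolding \<beta>_def
        by (rule prob_no_giant[OF Gn assms(2) \<alpha> L _ _ _ _ _ pab]) (use a b k_def in auto)
      ultimately show ?case unfolding err_def \<gamma>_def by linarith
    qed
    have "(\<lambda>n. prob_giant_component (G n) p \<alpha>) \<longlonglongrightarrow> 1"
    proof (rule tendsto_sandwich[OF lower])
      show "eventually (\<lambda>n. prob_giant_component (G n) p \<alpha> \<le> 1) sequentially"
        using giant_bounds(2) by simp
      show "(\<lambda>n. 1 - err (real (card (verts (G n))))) \<longlonglongrightarrow> 1"
        using tendsto_diff[OF tendsto_const err, of 1] by simp
    qed simp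
    then show "\<exists>\<alpha>>0. (\<lambda>n. prob_giant_component (G n) p \<alpha>) \<longlonglongrightarrow> 1" using \<alpha> by blast
  }
qed

end
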